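(* Let $\widetilde P$ be a pre-immersed pair of pants with closed geodesic boundary component $\gamma$ and another boundary element $\alpha^{k_\alpha}$. The Lasso function $La(\gamma,\alpha^{k_\alpha})$, in the case where $\alpha^{k_\alpha}$ is a cusp or a cone point of angle $\le\frac{\pi}{2}$, can be computed as follows. (1) When $\alpha^{k_\alpha}$ is a cusp, $$La(\gamma,\alpha^{k_\alpha})=4\,\mathcal L\Bigl(\frac{1}{1+e^{\bar m_\alpha}}\Bigr),$$ where $\bar m_\alpha$ is the length of the truncated part, from $\gamma$ to the first natural collar of the cusp $\alpha^{k_\alpha}$, of the seam $\sigma_\alpha$ joining $\gamma$ to $\alpha^{k_\alpha}$. (2) When $\alpha^{k_\alpha}$ is a cone point of angle $\theta=k_\alpha\theta(\alpha)\le\frac\pi2$, $$La(\gamma,\alpha^{k_\alpha})=2\operatorname{Re}\{\mathcal L(z)-\mathcal L(1/z)\},\qquad z:=\frac{\sinh m_\alpha+\tan(\theta/2)}{\sinh m_\alpha+i},$$ where $m_\alpha$ is the length of the seam $\sigma_\alpha$ from $\gamma$ to the cone point $\alpha^{k_\alpha}$.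
   Context: A hyperbolic pair of pants is a hyperbolic surface of genus $0$ with three boundary elements, each a closed geodesic, a cusp, or a cone point. The pair of pants $\widetilde P$ arises as follows: $\mu$ is an orthogeodesic on a hyperbolic cone surface joining boundary elements $\alpha,\beta$ (geodesic boundary components, cusps or cone points) carrying positive integer grades $k_\alpha,k_\beta$; $\gamma$ is the closed geodesic freely homotopic to $\alpha^{k_\alpha}*\mu*\beta^{k_\beta}*\mu^{-1}$; and $\widetilde P$ is the hyperbolic pair of pants with boundary elements $\alpha^{k_\alpha},\beta^{k_\beta},\gamma$, whose length or angle parameters are $k_\alpha$ times that of $\alpha$, $k_\beta$ times that of $\beta$, and the length of $\gamma$. Thus if $\alpha$ is a cone point of angle $\theta(\alpha)$, then $\alpha^{k_\alpha}$ is a cone point of angle $k_\alpha\theta(\alpha)$; if $\alpha$ is a cusp, so is $\alpha^{k_\alpha}$. The seam $\sigma_\alpha$ is the simple geodesic arc orthogonal to $\gamma$ and going to $\alpha^{k_\alpha}$. The first natural collar of a cusp is the open horoball neighbourhood whose boundary horocycle has length $2$. $\mathcal L(z)=\operatorname{Li}_2(z)+\frac12\operatorname{Log}(z)\operatorname{Log}(1-z)$ is the Rogers dilogarithm on $\mathbb C\setminus((-\infty,0]\cup[1,\infty))$ (principal branches). **Lasso function.** $La(\gamma,\alpha^{k_\alpha})$ is the Liouville measure of the set of unit tangent vectors $v$ on $\widetilde P$ giving rise to lassos with the foot on $\gamma$ and looping counterclockwise around $\alpha^{k_\alpha}$, and whose maximal geodesic extension is not homotopic (rel boundary) to the simple orthogeodesic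 from $\gamma$ to itself. The vector $v$ is tangent to the lasso between its footpoint on $\gamma$ and its point closest to $\alpha^{k_\alpha}$. In the upper half plane Liouville measure is $\frac{2\,dx\,dy\,dt}{(x-y)^2}$, where $x,y$ are the endpoints of the geodesic and $t$ is arc length. Explicitly, $[s,t]$ denoting the complete geodesic of the upper half plane with endpoints $s,t$: - Cusp: lift the cusp to $\infty$ so that $[0,2a]$ and $[2,2+2a]$ are lifts of $\gamma$, with $a=e^{-\bar m_\alpha}$. The relevant vectors lift to vectors tangent to geodesics $[x,y]$ with $x<0$, $2<y<2+2a$, based between $\tilde q=[x,y]\cap[2,2+2a]$ and the highest point $\tilde p$ of $[x,y]$, and pointing from $\tilde q$ towards $\tilde p$. - Cone point: via the developing map, lift the cone point to $i$ so that two of the lifts of $\gamma$ are $[-b,-a]$ and $[a,b]$, $0<a<b<1$. The relevant vectors lift to vectors tangent to geodesics $[x,y]$ with $a<y<b$, $-1/y<x<-b$, based between $\tilde q=[x,y]\cap[a,b]$ and the point $\tilde p$ of $[x,y]$ closest to $i$, and pointing from $\tilde q$ towards $\tilde p$.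
   Formalization: In (2), tan(θ/2) is corrected to cot(θ/2), as the printed formula fails (as θ→0 it tends to 0 while La does not); in (1), neighbouring lifts of γ around the cusp are required to be disjoint (a<1), so that the simple orthogeodesic from γ to itself exists. *)

theory Defs
  imports "HOL-Analysis.Analysis"
begin

section \<open>The Rogers dilogarithm\<close>

text \<open>Principal branch of the dilogarithm, meaningful for \<open>z\<close> outside \<open>[1,\<infinity>)\<close>. At \<open>t = 0\<close> the
  integrand is \<open>0\<close> by the convention on division; a single point does not affect the integral.\<close>

definition Li2 :: "complex \<Rightarrow> complex" where
  "Li2 z = - integral {0..1} (\<lambda>t::real. Ln (1 - of_real t * z) / of_real t)"

definition Rogers_L :: "complex \<Rightarrow> complex" where
  "Rogers_L z = Li2 z + Ln z * Ln (1 - z) / 2"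


section \<open>Geodesics of the upper half plane\<close>

datatype ideal = At real | Infty

fun coord :: "ideal \<Rightarrow> real" where
  "coord (At x) = x"
| "coord Infty = undefined"

text \<open>\<open>geod p q\<close> is the unit speed parametrisation of the complete geodesic running from the ideal
  point \<open>p\<close> to the ideal point \<open>q \<noteq> p\<close>. Time \<open>0\<close> is the highest point of a half circle, and the
  point of height \<open>1\<close> of a vertical line.\<close>

fun geod :: "ideal \<Rightarrow> ideal \<Rightarrow> real \<Rightarrow> complex" where
  "geod (At x) (At y) t =
     Complex ((x + y) / 2 + (y - x) / 2 * tanh t) (\<bar>y - x\<bar> / 2 / cosh t)"
| "geod (At x) Infty t = Complex x (exp t)"
| "geod Infty (At x) t = Complex x (exp (- t))"
| "geod Infty Infty t = undefined"

definition geod_vel :: "ideal \<Rightarrow> ideal \<Rightarrow> real \<Rightarrow> complex" where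
  "geod_vel p q t = vector_derivative (geod p q) (at t)"

text \<open>The unoriented geodesic \<open>[x,y]\<close>.\<close>

definition gline :: "real \<Rightarrow> real \<Rightarrow> complex set" where
  "gline x y = range (geod (At x) (At y))"

definition hdist :: "complex \<Rightarrow> complex \<Rightarrow> real" where
  "hdist z w = arcosh (1 + (norm (z - w))\<^sup>2 / (2 * Im z * Im w))"

definition hyp_length :: "(real \<Rightarrow> complex) \<Rightarrow> real \<Rightarrow> real \<Rightarrow> real" where
  "hyp_length c s t =
     integral {s..t} (\<lambda>u. norm (vector_derivative c (at u)) / Im (c u))"

text \<open>\<open>p, q, r\<close> are distinct and follow each other in the positive cyclic order of the ideal
  boundary.\<close>

fun cyclic :: "ideal \<Rightarrow> ideal \<Rightarrow> ideal \<Rightarrow> bool" where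
  "cyclic (At a) (At b) (At c) \<longleftrightarrow> a < b \<and> b < c \<or> b < c \<and> c < a \<or> c < a \<and> a < b"
| "cyclic Infty (At b) (At c) \<longleftrightarrow> b < c"
| "cyclic (At a) Infty (At c) \<longleftrightarrow> c < a"
| "cyclic (At a) (At b) Infty \<longleftrightarrow> a < b"
| "cyclic _ _ _ \<longleftrightarrow> False"


section \<open>Unit tangent vectors and Liouville measure\<close>

text \<open>A unit tangent vector is a pair of a base point and a velocity. The vector at time \<open>t\<close> on the
  geodesic running from \<open>x\<close> to \<open>y\<close> has coordinates \<open>(x, y, t)\<close>. Vectors tangent to vertical geodesics
  have no such coordinates; they are a null set.\<close>

definition tvec :: "real \<Rightarrow> real \<Rightarrow> real \<Rightarrow> complex \<times> complex" where
  "tvec x y t = (geod (At x) (At y) t, geod_vel (At x) (At y) t)"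

definition Liouville :: "(complex \<times> complex) measure" where
  "Liouville =
     distr (density lborel (\<lambda>(x, y, t::real). ennreal (2 / (x - y)\<^sup>2))) borel
       (\<lambda>(x, y, t). tvec x y t)"

text \<open>The unit vectors that are based on the geodesic segment between \<open>q\<close> and \<open>p\<close>, tangent to it, and
  pointing from \<open>q\<close> towards \<open>p\<close>.\<close>

definition seg_vectors :: "complex \<Rightarrow> complex \<Rightarrow> (complex \<times> complex) set" where
  "seg_vectors q p =
     {tvec u w t | u w t. u \<noteq> w \<and>
        (\<exists>s r. geod (At u) (At w) s = q \<and> geod (At u) (At w) r = p \<and> s \<le> t \<and> t \<le> r)}"


section \<open>Hyperbolic pairs of pants\<close>

text \<open>Boundary elements with their length, respectively cone angle.\<close>

datatype boundary_element = Geodesic real | Cusp | Cone real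

text \<open>The boundary element \<open>\<alpha>\<^sup>k\<close>.\<close>

fun grade :: "nat \<Rightarrow> boundary_element \<Rightarrow> boundary_element" where
  "grade k (Geodesic l) = Geodesic (real k * l)"
| "grade k Cusp = Cusp"
| "grade k (Cone \<theta>) = Cone (real k * \<theta>)"

text \<open>A pair of pants consists of a (generalised) right-angled hexagon and its mirror image, glued
  along the three seams, which join the boundary elements pairwise. The hexagon is placed in the upper
  half plane and traversed counterclockwise. A seam is an arc of a complete geodesic between two times,
  which are infinite at a cusp.\<close>

record seam =
  seam_src :: ideal
  seam_tgt :: ideal
  seam_beg :: ereal
  seam_end :: ereal

definition seam_pt :: "seam \<Rightarrow> real \<Rightarrow> complex" where
  "seam_pt c = geod (seam_src c) (seam_tgt c)"

definition seam_vel :: "seam \<Rightarrow> real \<Rightarrow> complex" where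
  "seam_vel c = geod_vel (seam_src c) (seam_tgt c)"

record hexagon =
  seam_\<gamma>\<alpha> :: seam
  seam_\<alpha>\<beta> :: seam
  seam_\<beta>\<gamma> :: seam

text \<open>Between the seams \<open>c\<close> and \<open>d\<close> the hexagon has a side on the geodesic from \<open>p\<close> to \<open>q\<close>, at right
  angles to both. Being traversed counterclockwise, the hexagon turns left at every corner. The side is
  half of a closed geodesic of length \<open>l\<close>.\<close>

definition boundary_side :: "seam \<Rightarrow> seam \<Rightarrow> real \<Rightarrow> ideal \<Rightarrow> ideal \<Rightarrow> bool" where
  "boundary_side c d l p q \<longleftrightarrow> p \<noteq> q \<and>
     (\<exists>r s u v. seam_end c = ereal r \<and> seam_beg d = ereal s \<and> u < v \<and> v - u = l / 2 \<and>
        geod p q u = seam_pt c r \<and> geod_vel p q u = \<i> * seam_vel c r \<and>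
        geod p q v = seam_pt d s \<and> seam_vel d s = \<i> * geod_vel p q v)"

text \<open>The seam \<open>c\<close> ends, and the seam \<open>d\<close> begins, at the given boundary element. At a cone point of
  angle \<open>\<theta>\<close> the interior angle of the hexagon is \<open>\<theta> / 2\<close>; at a cusp the two seams are asymptotic.\<close>

fun meet_at :: "boundary_element \<Rightarrow> seam \<Rightarrow> seam \<Rightarrow> bool" where
  "meet_at (Geodesic l) c d \<longleftrightarrow> (\<exists>p q. boundary_side c d l p q)"
| "meet_at Cusp c d \<longleftrightarrow> seam_end c = \<infinity> \<and> seam_beg d = - \<infinity> \<and> seam_tgt c = seam_src d \<and>
     cyclic (seam_src c) (seam_tgt c) (seam_tgt d)"
| "meet_at (Cone \<theta>) c d \<longleftrightarrow> 0 < \<theta> \<and> \<theta> < 2 * pi \<and>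
     (\<exists>r s. seam_end c = ereal r \<and> seam_beg d = ereal s \<and> seam_pt c r = seam_pt d s \<and>
        seam_vel d s = cis (pi - \<theta> / 2) * seam_vel c r)"

definition is_seam :: "seam \<Rightarrow> bool" where
  "is_seam c \<longleftrightarrow> seam_src c \<noteq> seam_tgt c \<and> seam_beg c < seam_end c"

text \<open>\<open>Q\<close> is a lift of the hexagon of the pair of pants with boundary elements \<open>A\<close>, \<open>B\<close> and the closed
  geodesic \<open>\<gamma>\<close> of length \<open>l\<close>. The parameters determine the pair of pants up to isometry, and the lift
  up to an isometry of the upper half plane. When the pair of pants comes from an orthogeodesic
  \<open>\<mu>\<close> between \<open>\<alpha>\<close> and \<open>\<beta>\<close> with grades \<open>j\<close> and \<open>k\<close>, then \<open>A = grade j \<alpha>\<close>, \<open>B = grade k \<beta>\<close>,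
  and \<open>\<mu>\<close> is the seam joining \<open>A\<close> and \<open>B\<close>.\<close>

definition pants_lift ::
  "boundary_element \<Rightarrow> boundary_element \<Rightarrow> real \<Rightarrow> hexagon \<Rightarrow> bool" where
  "pants_lift A B l Q \<longleftrightarrow>
     is_seam (seam_\<gamma>\<alpha> Q) \<and> is_seam (seam_\<alpha>\<beta> Q) \<and> is_seam (seam_\<beta>\<gamma> Q) \<and>
     meet_at A (seam_\<gamma>\<alpha> Q) (seam_\<alpha>\<beta> Q) \<and>
     meet_at B (seam_\<alpha>\<beta> Q) (seam_\<beta>\<gamma> Q) \<and>
     meet_at (Geodesic l) (seam_\<beta>\<gamma> Q) (seam_\<gamma>\<alpha> Q)"


section \<open>Normalised lifts\<close>

text \<open>The reflection in the seam between \<open>\<alpha>\<close> and \<open>\<beta>\<close> takes the hexagon to a lift of the mirror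
  hexagon, hence \<open>\<gamma>\<close> to the next lift of \<open>\<gamma>\<close> around \<open>\<alpha>\<close>. In a normalised lift this seam lies on a
  vertical line. The lifts \<open>[0, 2 a]\<close> and \<open>[2, 2 + 2 a]\<close> are disjoint precisely when \<open>a < 1\<close>.\<close>

definition vertical_reflection :: "real \<Rightarrow> complex \<Rightarrow> complex" where
  "vertical_reflection m z = of_real (2 * m) - cnj z"

definition cusp_normalised :: "hexagon \<Rightarrow> real \<Rightarrow> bool" where
  "cusp_normalised Q a \<longleftrightarrow> 0 < a \<and> a < 1 \<and>
     seam_end (seam_\<gamma>\<alpha> Q) = \<infinity> \<and> seam_tgt (seam_\<gamma>\<alpha> Q) = Infty \<and>
     (\<exists>l. boundary_side (seam_\<beta>\<gamma> Q) (seam_\<gamma>\<alpha> Q) l (At 2) (At (2 + 2 * a))) \<and>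
     (\<exists>m. seam_src (seam_\<alpha>\<beta> Q) = Infty \<and> seam_tgt (seam_\<alpha>\<beta> Q) = At m \<and>
        vertical_reflection m ` gline 2 (2 + 2 * a) = gline 0 (2 * a))"

definition cone_normalised :: "hexagon \<Rightarrow> real \<Rightarrow> real \<Rightarrow> bool" where
  "cone_normalised Q a b \<longleftrightarrow> 0 < a \<and> a < b \<and> b < 1 \<and>
     (\<exists>r. seam_end (seam_\<gamma>\<alpha> Q) = ereal r \<and> seam_pt (seam_\<gamma>\<alpha> Q) r = \<i>) \<and>
     (\<exists>l. boundary_side (seam_\<beta>\<gamma> Q) (seam_\<gamma>\<alpha> Q) l (At a) (At b)) \<and>
     (\<exists>m. seam_src (seam_\<alpha>\<beta> Q) = Infty \<and> seam_tgt (seam_\<alpha>\<beta> Q) = At m \<and>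
        vertical_reflection m ` gline a b = gline (- b) (- a))"

text \<open>Length of the seam from \<open>\<gamma>\<close> to the cone point (seams have unit speed).\<close>

definition seam_length :: "hexagon \<Rightarrow> real" where
  "seam_length Q = real_of_ereal (seam_end (seam_\<gamma>\<alpha> Q) - seam_beg (seam_\<gamma>\<alpha> Q))"

text \<open>In a lift with the cusp at infinity, the boundary horocycle of the first natural collar lies at a
  constant height. The two hexagons contain equal halves of this horocycle of length \<open>2\<close>, and the
  half in \<open>Q\<close> runs from the seam between \<open>\<alpha>\<close> and \<open>\<beta>\<close> to the seam between \<open>\<gamma>\<close> and \<open>\<alpha>\<close>.\<close>

definition collar_height :: "hexagon \<Rightarrow> real" where
  "collar_height Q = (THE h. 0 < h \<and>
     2 * hyp_length (\<lambda>x. Complex x h) (coord (seam_tgt (seam_\<alpha>\<beta> Q))) (coord (seam_src (seam_\<gamma>\<alpha> Q)))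
       = 2)"

definition truncated_seam_length :: "hexagon \<Rightarrow> real" where
  "truncated_seam_length Q = (THE l. \<exists>s r. seam_beg (seam_\<gamma>\<alpha> Q) = ereal s \<and>
     Im (seam_pt (seam_\<gamma>\<alpha> Q) r) = collar_height Q \<and> l = r - s)"


section \<open>The Lasso function\<close>

definition cusp_lasso_vectors :: "real \<Rightarrow> (complex \<times> complex) set" where
  "cusp_lasso_vectors a =
     \<Union> {seg_vectors q p | x y q p. x < 0 \<and> 2 < y \<and> y < 2 + 2 * a \<and>
          q \<in> gline x y \<inter> gline 2 (2 + 2 * a) \<and>
          p \<in> gline x y \<and> (\<forall>z \<in> gline x y. Im z \<le> Im p)}"

definition cone_lasso_vectors :: "real \<Rightarrow> real \<Rightarrow> (complex \<times> complex) set" where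
  "cone_lasso_vectors a b =
     \<Union> {seg_vectors q p | x y q p. a < y \<and> y < b \<and> - 1 / y < x \<and> x < - b \<and>
          q \<in> gline x y \<inter> gline a b \<and>
          p \<in> gline x y \<and> (\<forall>z \<in> gline x y. hdist \<i> p \<le> hdist \<i> z)}"

text \<open>A given \<open>Q\<close> is normalised in at most one way.\<close>

definition lasso_vectors :: "hexagon \<Rightarrow> (complex \<times> complex) set" where
  "lasso_vectors Q =
     \<Union> {cusp_lasso_vectors a | a. cusp_normalised Q a} \<union>
     \<Union> {cone_lasso_vectors a b | a b. cone_normalised Q a b}"

text \<open>For a cone point of angle \<open>\<theta>\<close> and seam length \<open>m\<close>, normalised to \<open>[a,b]\<close> as above, one has
  \<open>tan (\<theta> / 2) = (a + b) / (1 - a b)\<close> and \<open>sinh m = (1 + a b) / (b - a)\<close>, so the cross ratio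
  \<open>2 b (a - \<i>) / ((a + b) (b - \<i>))\<close> equals \<open>(sinh m + cot (\<theta> / 2)) / (sinh m + \<i>)\<close>. This is the
  argument of the dilogarithms in the value of the Lasso function. Replacing \<open>cot (\<theta> / 2)\<close>
  by \<open>tan (\<theta> / 2)\<close>, as the source prints it, gives a false formula: with \<open>a : b\<close> fixed and
  \<open>\<theta> \<longrightarrow> 0\<close> that value would tend to \<open>0\<close>, and not to the positive value for a cusp.\<close>

definition La :: "hexagon \<Rightarrow> real" where
  "La Q = measure Liouville (lasso_vectors Q)"

end

theory Submission
  imports Defs
begin

text \<open>
  Both values are Liouville volumes. A vector of the lasso set is given by the endpoints \<open>x, y\<close> of its
  geodesic and its arc length parameter, and for fixed \<open>x, y\<close> the parameter runs over the segment from
  the intersection \<open>q\<close> with the lift of \<open>\<gamma>\<close> to the point \<open>p\<close> that is highest, respectively closest to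
  \<open>\<i>\<close>. By \<open>emeasure_Liouville_fibred\<close> the volume is the double integral of twice the length of this
  segment against \<open>dx dy / (x - y)\<^sup>2\<close>. The length is half the logarithm of an explicit rational function
  (\<open>gline_Int_gline\<close>, \<open>highest_point_iff\<close>, \<open>closest_point_iff\<close>).

  For the cusp the inner integral is elementary, and the outer one has the primitive
  \<open>2 L (1 - 2 / y) - 2 L (1 - y / d)\<close> with \<open>d = 2 + 2 a\<close>, which gives \<open>4 L (a / (1 + a))\<close>
  (\<open>measure_cusp_lasso_vectors\<close>).

  For the cone point, twice the length is \<open>- Re (Ln (r a) + Ln (r b))\<close>, where \<open>r c\<close> is the cross ratio
  \<open>(y - c) (x - \<i>) / ((x - c) (y - \<i>))\<close>. The function \<open>- 2 Re (L (r c))\<close> has the mixed second derivative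
  \<open>- Re (Ln (r c)) / (x - y)\<^sup>2\<close> (\<open>cr_partial_deriv_x\<close>, \<open>Rogers_L_cross_ratio_deriv_y\<close>), so the double integral
  reduces to the boundary of the domain. The side \<open>x = - b\<close> gives the difference of \<open>L\<close> at the two
  corners. On the side \<open>x = - 1 / y\<close> the chord passes through \<open>\<i>\<close>, the cross ratios are purely imaginary, and
  the contributions of \<open>a\<close> and \<open>b\<close> cancel by symmetry. With the reflection formula for \<open>L\<close> this yields
  \<open>2 Re (L z - L (1 / z))\<close> for \<open>z = 2 b (a - \<i>) / ((a + b) (b - \<i>))\<close> (\<open>measure_cone_lasso_vectors\<close>).

  It remains to read off \<open>a\<close> and \<open>b\<close> from the hexagon. At a cusp the seam from \<open>\<gamma>\<close> is the vertical line
  over \<open>2 + a\<close>, it starts at height \<open>a\<close>, and the collar lies at height \<open>1\<close>, so the truncated seam has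
  length \<open>- ln a\<close>. At a cone point the perpendicular to \<open>[a,b]\<close> through \<open>\<i>\<close> makes the angle \<open>\<theta> / 2\<close> with
  the vertical, which gives \<open>sinh m = (1 + a b) / (b - a)\<close> and \<open>cot (\<theta> / 2) = (1 - a b) / (a + b)\<close>
  (\<open>cone_seam\<close>, \<open>seam_length_and_angle\<close>).
\<close>


section \<open>The Rogers dilogarithm as a holomorphic function\<close>

text \<open>The plane cut along \<open>[1,\<infinity>)\<close>, the domain on which \<open>Li2\<close> is holomorphic.\<close>

definition slit :: "complex set" where
  "slit = {z. Im z \<noteq> 0 \<or> Re z < 1}"

lemma slit_scale:
  assumes "z \<in> slit" "0 \<le> t" "t \<le> 1"
  shows "1 - of_real t * z \<notin> \<real>\<^sub>\<le>\<^sub>0"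
proof
  assume "1 - of_real t * z \<in> \<real>\<^sub>\<le>\<^sub>0"
  hence 1: "t * Re z \<ge> 1" "t * Im z = 0"
    by (auto simp: complex_nonpos_Reals_iff)
  hence "t \<noteq> 0" by auto
  hence "Re z < 1" using 1 assms(1) by (auto simp: slit_def)
  moreover have "t * Re z \<le> max 0 (Re z)"
    using assms(2,3) by (cases "Re z \<ge> 0") (auto simp: mult_left_le_one_le mult_nonneg_nonpos)
  ultimately show False using 1 by linarith
qed

lemma open_slit: "open slit"
proof -
  have "slit = {z. Im z \<noteq> 0} \<union> {z. Re z < 1}" by (auto simp: slit_def)
  moreover have "open {z. Im z \<noteq> 0}"
    by (intro open_Collect_neq continuous_intros)
  moreover have "open {z. Re z < 1}"
    by (intro open_Collect_less continuous_intros)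
  ultimately show ?thesis by (metis open_Un)
qed

lemma Ln_scaled_has_integral:
  assumes z: "z \<in> slit"
  shows "((\<lambda>t. - inverse (1 - of_real t * z)) has_integral (if z = 0 then - 1 else Ln (1 - z) / z)) {0..1}"
proof (cases "z = 0")
  case True
  show ?thesis using has_integral_const_real[of "-1::complex" 0 1] True by simp
next
  case False
  have "((\<lambda>t. - inverse (1 - of_real t * z)) has_integral
          (Ln (1 - of_real 1 * z) / z - Ln (1 - of_real 0 * z) / z)) {0..1}"
  proof (rule fundamental_theorem_of_calculus)
    fix t :: real assume t: "t \<in> {0..1}"
    have "((\<lambda>s. Ln (1 - s * z) / z) has_field_derivative - inverse (1 - of_real t * z)) (at (of_real t))"
      using slit_scale[OF z, of t] t False by (auto intro!: derivative_eq_intros simp: divide_simps)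
    from has_vector_derivative_at_within[OF has_vector_derivative_real_field[OF this]]
    show "((\<lambda>t. Ln (1 - of_real t * z) / z) has_vector_derivative - inverse (1 - of_real t * z)) (at t within {0..1})" .
  qed simp
  thus ?thesis using False by simp
qed

text \<open>Differentiation under the integral sign. The value at \<open>0\<close> is separate, since the quotient
  \<open>Ln (1 - z) / z\<close> has a removable singularity there.\<close>

lemma Li2_has_field_derivative:
  assumes z: "z \<in> slit"
  shows "(Li2 has_field_derivative (if z = 0 then 1 else - Ln (1 - z) / z)) (at z)"
proof -
  \<comment> \<open>the integrand with its singularity at \<open>t = 0\<close> removed\<close>
  define g where "g = (\<lambda>w (t::real). if t = 0 then - w else Ln (1 - of_real t * w) / of_real t)"
  obtain e where e: "e > 0" "ball z e \<subseteq> slit"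
    using open_slit z openE by blast
  have g_deriv: "((\<lambda>w. g w t) has_field_derivative - inverse (1 - of_real t * w)) (at w within ball z e)"
    if "w \<in> ball z e" "t \<in> cbox 0 1" for w t
  proof (cases "t = 0")
    case True
    thus ?thesis by (auto simp: g_def intro!: derivative_eq_intros)
  next
    case False
    have "1 - of_real t * w \<notin> \<real>\<^sub>\<le>\<^sub>0"
      using slit_scale[of w t] that e by auto
    thus ?thesis using False
      by (auto simp: g_def divide_inverse intro!: derivative_eq_intros)
  qed
  have g_int: "g w integrable_on cbox 0 1" if w: "w \<in> ball z e" for w
  proof (intro integrable_continuous, unfold continuous_on_eq_continuous_within, intro ballI)
    fix t :: real assume t: "t \<in> cbox 0 1"
    show "continuous (at t within cbox 0 1) (g w)"
    proof (cases "t = 0")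
      case True
      have "((\<lambda>s. Ln (1 - s * w)) has_field_derivative (- w)) (at 0)"
        by (auto intro!: derivative_eq_intros)
      hence "((\<lambda>h. Ln (1 - h * w) / h) \<longlongrightarrow> - w) (at 0)"
        by (simp add: DERIV_def)
      hence "((\<lambda>t::real. Ln (1 - of_real t * w) / of_real t) \<longlongrightarrow> - w) (at 0 within cbox 0 1)"
        by (rule filterlim_compose) 
           (auto simp: filterlim_at eventually_at_filter intro!: tendsto_eq_intros)
      hence "(g w \<longlongrightarrow> - w) (at 0 within cbox 0 1)"
        by (rule Lim_transform_eventually) (auto simp: g_def eventually_at_filter)
      thus ?thesis using True by (simp add: continuous_within g_def)
    next
      case False
      have n: "1 - of_real t * w \<notin> \<real>\<^sub>\<le>\<^sub>0"
        using slit_scale[of w t] t w e by auto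
      have "isCont (\<lambda>t. Ln (1 - of_real t * w) / of_real t) t"
        using n False by (intro continuous_intros) auto
      moreover have "eventually (\<lambda>s. g w s = Ln (1 - of_real s * w) / of_real s) (nhds t)"
        using t1_space_nhds[OF False] by eventually_elim (auto simp: g_def)
      ultimately have "isCont (g w) t"
        by (subst isCont_cong) 
      thus ?thesis by (rule continuous_at_imp_continuous_within)
    qed
  qed
  have cont: "continuous_on (ball z e \<times> cbox 0 1) (\<lambda>(w, t). - inverse (1 - of_real t * w))"
  proof -
    have "1 - of_real (snd p) * fst p \<noteq> 0" if "p \<in> ball z e \<times> cbox 0 1" for p :: "complex \<times> real"
    proof -
      have "1 - of_real (snd p) * fst p \<notin> \<real>\<^sub>\<le>\<^sub>0"
        by (rule slit_scale) (use that e in auto)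
      thus ?thesis by auto
    qed
    thus ?thesis unfolding split_beta by (intro continuous_intros) auto
  qed
  have "((\<lambda>w. integral (cbox 0 1) (g w)) has_field_derivative
          integral (cbox 0 1) (\<lambda>t. - inverse (1 - of_real t * z))) (at z within ball z e)"
    by (rule leibniz_rule_field_derivative[OF g_deriv g_int cont]) (use e in auto)
  hence "((\<lambda>w. - integral {0..1} (g w)) has_field_derivative
          - integral {0..1} (\<lambda>t. - inverse (1 - of_real t * z))) (at z)"
    using e at_within_open[of z "ball z e"] DERIV_minus by fastforce
  moreover have "(\<lambda>w. - integral {0..1} (g w)) = Li2"
  proof
    fix w
    have "integral {0..1} (g w) = integral {0..1} (\<lambda>t::real. Ln (1 - of_real t * w) / of_real t)"
      by (rule integral_spike[of "{0}"]) (auto simp: g_def)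
    thus "- integral {0..1} (g w) = Li2 w" by (simp add: Li2_def)
  qed
  moreover have "- integral {0..1} (\<lambda>t. - inverse (1 - of_real t * z)) =
      (if z = 0 then 1 else - Ln (1 - z) / z)"
    unfolding integral_unique[OF Ln_scaled_has_integral[OF z]] by simp
  ultimately show ?thesis by (simp only:)
qed

lemma isCont_Li2: "z \<in> slit \<Longrightarrow> isCont Li2 z"
  using Li2_has_field_derivative DERIV_isCont by blast

text \<open>The plane without the two cuts \<open>(-\<infinity>,0]\<close> and \<open>[1,\<infinity>)\<close>.\<close>

definition Rogers_dom :: "complex set" where
  "Rogers_dom = {z. Im z \<noteq> 0 \<or> 0 < Re z \<and> Re z < 1}"

text \<open>The derivative of the Rogers dilogarithm on this domain.\<close>

definition Rogers_D :: "complex \<Rightarrow> complex" where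
  "Rogers_D z = - (Ln (1 - z) / z + Ln z / (1 - z)) / 2"

lemma Rogers_domD:
  assumes "z \<in> Rogers_dom"
  shows "z \<in> slit" "z \<noteq> 0" "z \<noteq> 1" "z \<notin> \<real>\<^sub>\<le>\<^sub>0" "1 - z \<notin> \<real>\<^sub>\<le>\<^sub>0"
  using assms by (auto simp: Rogers_dom_def slit_def complex_nonpos_Reals_iff)

lemma Rogers_L_has_field_derivative:
  assumes z: "z \<in> Rogers_dom"
  shows "(Rogers_L has_field_derivative Rogers_D z) (at z)"
proof -
  note d = Rogers_domD[OF z]
  have L1: "((\<lambda>z. Ln (1 - z)) has_field_derivative - inverse (1 - z)) (at z)"
  proof -
    have "((\<lambda>z. 1 - z) has_field_derivative 0 - 1) (at z)"
      by (intro derivative_intros)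
    from DERIV_chain2[OF has_field_derivative_Ln[OF d(5)] this] show ?thesis by simp
  qed
  have "((\<lambda>z. Li2 z + Ln z * Ln (1 - z) / 2) has_field_derivative
      (- Ln (1 - z) / z) + (inverse z * Ln (1 - z) + - inverse (1 - z) * Ln z) / 2) (at z)"
    using Li2_has_field_derivative[OF d(1)] d
    by (intro DERIV_add DERIV_cdivide DERIV_mult has_field_derivative_Ln L1) auto
  also have "(- Ln (1 - z) / z) + (inverse z * Ln (1 - z) + - inverse (1 - z) * Ln z) / 2 = Rogers_D z"
  proof -
    have "- A * p + (p * A + - q * B) / 2 = - (A * p + B * q) / 2" for A B p q :: complex
      by (simp add: field_simps)
    thus ?thesis unfolding Rogers_D_def divide_inverse[of _ z] divide_inverse[of _ "1 - z"] .
  qed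
  finally show ?thesis by (simp add: Rogers_L_def[abs_def])
qed

lemma Li2_0 [simp]: "Li2 0 = 0"
  by (simp add: Li2_def)

lemma Rogers_L_0 [simp]: "Rogers_L 0 = 0"
  by (simp add: Rogers_L_def)

text \<open>The point \<open>0\<close> is the end of a cut, but \<open>Ln z\<close> grows only logarithmically there while
  \<open>Ln (1 - z)\<close> vanishes to first order. Cross ratios take the value \<open>0\<close> at the ends of the lift of
  \<open>\<gamma>\<close>, so the primitives below need continuity at this point.\<close>

lemma isCont_Rogers_L_0: "isCont Rogers_L 0"
proof -
  have "((\<lambda>z. Ln z * Ln (1 - z) / 2) \<longlongrightarrow> 0) (at 0)"
  proof (rule Lim_null_comparison)
    have "eventually (\<lambda>z::complex. norm (- z) < 1/2) (at 0)"
      by (rule order_tendstoD(2)[of _ 0]) (auto intro!: tendsto_eq_intros)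
    hence ev: "eventually (\<lambda>z::complex. norm (Ln (1 - z)) \<le> 2 * norm z) (at 0)"
    proof eventually_elim
      case (elim z)
      thus ?case using norm_Ln_le[of "- z"] by simp
    qed
    have "eventually (\<lambda>z::complex. z \<noteq> 0) (at 0)" by (simp add: eventually_at_filter)
    with ev show "eventually (\<lambda>z. norm (Ln z * Ln (1 - z) / 2) \<le> (\<bar>ln (norm z)\<bar> + pi) * norm z) (at (0::complex))"
    proof eventually_elim
      case (elim z)
      have "norm (Ln z) \<le> \<bar>Re (Ln z)\<bar> + \<bar>Im (Ln z)\<bar>" by (rule cmod_le)
      also have "\<bar>Im (Ln z)\<bar> \<le> pi" using mpi_less_Im_Ln[OF elim(2)] Im_Ln_le_pi[OF elim(2)] by auto
      also have "Re (Ln z) = ln (norm z)" using elim by simp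
      finally have "norm (Ln z) \<le> \<bar>ln (norm z)\<bar> + pi" by simp
      hence "norm (Ln z) * norm (Ln (1 - z)) \<le> (\<bar>ln (norm z)\<bar> + pi) * (2 * norm z)"
        using elim by (intro mult_mono) auto
      thus ?case by (simp add: norm_mult norm_divide)
    qed
    have "((\<lambda>x::real. (\<bar>ln x\<bar> + pi) * x) \<longlongrightarrow> 0) (at_right 0)"
    proof -
      have "((\<lambda>x::real. ln (inverse x) / inverse x) \<longlongrightarrow> 0) (at_right 0)"
        by (rule filterlim_compose[OF ln_x_over_x_tendsto_0 filterlim_inverse_at_top_right])
      hence "((\<lambda>x::real. \<bar>ln (inverse x) / inverse x\<bar> + pi * x) \<longlongrightarrow> \<bar>0\<bar> + pi * 0) (at_right 0)"
        by (intro tendsto_intros)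
      hence "((\<lambda>x::real. \<bar>ln (inverse x) / inverse x\<bar> + pi * x) \<longlongrightarrow> 0) (at_right 0)" by simp
      thus ?thesis
        by (rule Lim_transform_eventually)
           (auto simp: eventually_at_filter ln_inverse abs_mult divide_inverse algebra_simps)
    qed
    moreover have "filterlim (\<lambda>z::complex. norm z) (at_right 0) (at 0)"
      by (auto simp: filterlim_at eventually_at_filter intro!: tendsto_eq_intros)
    ultimately show "((\<lambda>z::complex. (\<bar>ln (norm z)\<bar> + pi) * norm z) \<longlongrightarrow> 0) (at 0)"
      by (rule filterlim_compose)
  qed
  hence "isCont (\<lambda>z. Ln z * Ln (1 - z) / 2) 0" by (simp add: continuous_at)
  hence "isCont (\<lambda>z. Li2 z + Ln z * Ln (1 - z) / 2) 0"
    using isCont_Li2[of 0] by (auto intro!: continuous_intros simp: slit_def)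
  thus ?thesis by (simp add: Rogers_L_def[abs_def])
qed

text \<open>The constant is \<open>\<pi>\<^sup>2/6\<close>, but its value is not needed: it cancels in the one place where the
  formula is used. The domain is star-shaped about \<open>1/2\<close>, so a vanishing derivative along the segment
  from \<open>1/2\<close> is enough.\<close>

lemma Rogers_L_reflection:
  assumes "z \<in> Rogers_dom"
  shows "Rogers_L z + Rogers_L (1 - z) = 2 * Rogers_L (1/2)"
proof -
  define S where "S = closed_segment (1/2) z"
  have S: "w \<in> Rogers_dom" "1 - w \<in> Rogers_dom" if "w \<in> S" for w
  proof -
    obtain u where u: "0 \<le> u" "u \<le> 1" and w: "w = (1 - u) *\<^sub>R (1/2) + u *\<^sub>R z"
      using \<open>w \<in> S\<close> by (auto simp: S_def in_segment)
    have Re: "Re w = (1 - u) / 2 + u * Re z" and Im: "Im w = u * Im z"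
      using w by (auto simp: complex_eq_iff)
    show "w \<in> Rogers_dom"
    proof (cases "Im w = 0")
      case True
      show ?thesis
      proof (cases "u = 0")
        case False
        with True Im assms have "0 < Re z" "Re z < 1" by (auto simp: Rogers_dom_def)
        hence "0 < u * Re z" "u * Re z < u" using False u by auto
        hence "0 < Re w" "Re w < 1" using Re u by (auto simp: field_simps)
        thus ?thesis by (auto simp: Rogers_dom_def)
      qed (use Re in \<open>auto simp: Rogers_dom_def\<close>)
    qed (auto simp: Rogers_dom_def)
    thus "1 - w \<in> Rogers_dom" by (auto simp: Rogers_dom_def)
  qed
  have "\<exists>c. \<forall>w\<in>S. Rogers_L w + Rogers_L (1 - w) = c"
  proof (rule has_field_derivative_zero_constant)
    fix w assume "w \<in> S"
    note S = S[OF this]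
    have "((\<lambda>w. 1 - w) has_field_derivative 0 - 1) (at w)"
      by (intro derivative_intros)
    from DERIV_chain2[OF Rogers_L_has_field_derivative[OF S(2)] this]
    have "((\<lambda>w. Rogers_L (1 - w)) has_field_derivative Rogers_D (1 - w) * (0 - 1)) (at w)" .
    hence "((\<lambda>w. Rogers_L w + Rogers_L (1 - w)) has_field_derivative
            Rogers_D w + Rogers_D (1 - w) * (0 - 1)) (at w within S)"
      using Rogers_L_has_field_derivative[OF S(1)]
      by (intro has_field_derivative_at_within[OF DERIV_add])
    thus "((\<lambda>w. Rogers_L w + Rogers_L (1 - w)) has_field_derivative 0) (at w within S)"
      by (simp add: Rogers_D_def algebra_simps flip: add_divide_distrib)
  qed (simp add: S_def)
  then obtain c where c: "\<And>w. w \<in> S \<Longrightarrow> Rogers_L w + Rogers_L (1 - w) = c" by blast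
  have "z \<in> S" "1/2 \<in> S" by (simp_all add: S_def)
  from this[THEN c] show ?thesis by simp
qed


section \<open>Geodesics and their intersections\<close>

lemma cosh_eq_tanh: "inverse (cosh t) ^ 2 = 1 - tanh t ^ 2" for t :: real
proof -
  have "cosh t ^ 2 * (inverse (cosh t) ^ 2) = cosh t ^ 2 * (1 - tanh t ^ 2)"
    using cosh_square_eq[of t] by (simp add: tanh_def field_simps)
  thus ?thesis by simp
qed

lemma geod_vel_At_At:
  "geod_vel (At x) (At y) t =
     Complex ((y - x) / 2 / (cosh t)\<^sup>2) (- (\<bar>y - x\<bar> / 2) * sinh t / (cosh t)\<^sup>2)"
proof -
  have "(geod (At x) (At y) has_vector_derivative
     Complex ((y - x) / 2 / (cosh t)\<^sup>2) (- (\<bar>y - x\<bar> / 2) * sinh t / (cosh t)\<^sup>2)) (at t)"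
  proof -
    have "((\<lambda>t. (x + y) / 2 + (y - x) / 2 * tanh t) has_field_derivative (y - x) / 2 * (1 - tanh t ^ 2)) (at t)"
      by (auto intro!: derivative_eq_intros)
    moreover have "((\<lambda>t. \<bar>y - x\<bar> / 2 / cosh t) has_field_derivative
        - (\<bar>y - x\<bar> / 2) * sinh t / (cosh t)\<^sup>2) (at t)"
      by (auto intro!: derivative_eq_intros simp: power2_eq_square)
    moreover have "(y - x) / 2 * (1 - tanh t ^ 2) = (y - x) / 2 / (cosh t)\<^sup>2"
      unfolding cosh_eq_tanh[symmetric] by (simp only: divide_inverse power_inverse)
    ultimately show ?thesis
      unfolding has_vector_derivative_complex_iff geod.simps complex.sel by (simp only: simp_thms)
  qed
  thus ?thesis unfolding geod_vel_def by (rule vector_derivative_at)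
qed

lemma geod_vel_Infty_At: "geod_vel Infty (At x) t = Complex 0 (- exp (- t))"
proof -
  have "(geod Infty (At x) has_vector_derivative Complex 0 (- exp (- t))) (at t)"
    unfolding has_vector_derivative_complex_iff
    by (auto intro!: derivative_eq_intros)
  thus ?thesis unfolding geod_vel_def by (rule vector_derivative_at)
qed

lemma geod_vel_At_Infty: "geod_vel (At x) Infty t = Complex 0 (exp t)"
proof -
  have "(geod (At x) Infty has_vector_derivative Complex 0 (exp t)) (at t)"
    unfolding has_vector_derivative_complex_iff
    by (auto intro!: derivative_eq_intros)
  thus ?thesis unfolding geod_vel_def by (rule vector_derivative_at)
qed

lemma geod_reverse: "geod (At y) (At x) t = geod (At x) (At y) (- t)"
  by (simp add: field_simps abs_minus_commute)

lemma Im_geod_pos: "x \<noteq> y \<Longrightarrow> 0 < Im (geod (At x) (At y) t)"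
  by simp

lemma Re_geod_strict_mono: "x < y \<Longrightarrow> s < t \<Longrightarrow> Re (geod (At x) (At y) s) < Re (geod (At x) (At y) t)"
  by simp

lemma geod_inj: "x < y \<Longrightarrow> geod (At x) (At y) s = geod (At x) (At y) t \<Longrightarrow> s = t"
  using Re_geod_strict_mono[of x y s t] Re_geod_strict_mono[of x y t s]
  by (cases s t rule: linorder_cases) (simp_all del: geod.simps)

lemma geod_circle:
  "(Re (geod (At x) (At y) t) - x) * (Re (geod (At x) (At y) t) - y) + (Im (geod (At x) (At y) t))\<^sup>2 = 0"
proof -
  have 1: "inverse (cosh t) ^ 2 = 1 - tanh t ^ 2" by (rule cosh_eq_tanh)
  have 2: "((x + y) / 2 + (y - x) / 2 * v - x) * ((x + y) / 2 + (y - x) / 2 * v - y) =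
      ((y - x) / 2)\<^sup>2 * (v\<^sup>2 - 1)" for v
    by (simp add: power2_eq_square field_simps)
  have 3: "(\<bar>y - x\<bar> / 2 / cosh t)\<^sup>2 = ((y - x) / 2)\<^sup>2 * inverse (cosh t) ^ 2"
    by (simp only: divide_inverse power_mult_distrib power2_abs)
  show ?thesis
    unfolding geod.simps complex.sel 2 3 1 by (simp only: right_diff_distrib)
qed

text \<open>Membership in a geodesic as an equation: the circle with diameter from \<open>x\<close> to \<open>y\<close>.\<close>

lemma gline_iff:
  assumes "x < y"
  shows "z \<in> gline x y \<longleftrightarrow> 0 < Im z \<and> (Re z - x) * (Re z - y) + (Im z)\<^sup>2 = 0"
proof
  assume "z \<in> gline x y"
  thus "0 < Im z \<and> (Re z - x) * (Re z - y) + (Im z)\<^sup>2 = 0"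
    using geod_circle[of x y] Im_geod_pos[of x y] assms by (auto simp: gline_def simp del: geod.simps)
next
  assume z: "0 < Im z \<and> (Re z - x) * (Re z - y) + (Im z)\<^sup>2 = 0"
  hence "0 < (Re z - x) * (y - Re z)"
  proof -
    have "(Re z - x) * (y - Re z) = (Im z)\<^sup>2" using z by (simp add: algebra_simps)
    thus ?thesis using z by simp
  qed
  hence b: "x < Re z" "Re z < y"
    using assms by (auto simp: zero_less_mult_iff)
  define q where "q = (Re z - x) / (y - Re z)"
  define t where "t = ln (sqrt q)"
  have q: "q > 0" using b by (simp add: q_def)
  have "tanh t = (q - 1) / (q + 1)"
    using q unfolding t_def by (subst tanh_ln_real) simp_all
  also have "\<dots> = (2 * Re z - x - y) / (y - x)"
    unfolding q_def using b by (simp add: divide_simps)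
  finally have "tanh t = (2 * Re z - x - y) / (y - x)" .
  hence R: "Re (geod (At x) (At y) t) = Re z" using assms by (simp add: field_simps)
  have "(Im (geod (At x) (At y) t))\<^sup>2 = (Im z)\<^sup>2"
    using geod_circle[of x y t] z unfolding R by (simp del: geod.simps)
  hence "Im (geod (At x) (At y) t) = Im z"
    using z Im_geod_pos[of x y t] assms by (subst (asm) power2_eq_iff_nonneg) (auto simp del: geod.simps)
  hence "geod (At x) (At y) t = z" using R by (simp add: complex_eq_iff del: geod.simps)
  thus "z \<in> gline x y" by (auto simp: gline_def simp del: geod.simps)
qed

text \<open>Two distinct points determine the geodesic, and the order of their times its orientation. The
  segment is run through from \<open>q\<close> to \<open>p\<close>, hence from \<open>y\<close> to \<open>x\<close>, which reverses the sign of the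
  times.\<close>

lemma seg_vectors_geod:
  assumes xy: "x < y" and t: "tp < tq"
  shows "seg_vectors (geod (At x) (At y) tq) (geod (At x) (At y) tp) = (\<lambda>t. tvec y x t) ` {- tq..- tp}"
proof (intro equalityI subsetI)
  fix v assume "v \<in> (\<lambda>t. tvec y x t) ` {- tq..- tp}"
  then obtain t where t: "v = tvec y x t" "- tq \<le> t" "t \<le> - tp" by auto
  have "geod (At y) (At x) (- tq) = geod (At x) (At y) tq" "geod (At y) (At x) (- tp) = geod (At x) (At y) tp"
    by (simp_all only: geod_reverse[of y x] minus_minus)
  thus "v \<in> seg_vectors (geod (At x) (At y) tq) (geod (At x) (At y) tp)"
    unfolding seg_vectors_def mem_Collect_eq using xy t by (metis order_less_irrefl)
next
  define q p where "q = geod (At x) (At y) tq" and "p = geod (At x) (At y) tp"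
  fix v assume "v \<in> seg_vectors (geod (At x) (At y) tq) (geod (At x) (At y) tp)"
  then obtain u w t s r where uw: "u \<noteq> w" and v: "v = tvec u w t" and sr: "s \<le> t" "t \<le> r"
    and q: "geod (At u) (At w) s = q" and p: "geod (At u) (At w) r = p"
    unfolding seg_vectors_def q_def p_def by blast
  have ne: "Re p < Re q" unfolding q_def p_def by (rule Re_geod_strict_mono[OF xy t])
  note eqs = geod_circle[of u w s] geod_circle[of u w r] geod_circle[of x y tq] geod_circle[of x y tp]
  have e: "(u + w - x - y) * Re z = u * w - x * y" if "z = p \<or> z = q" for z
    using that eqs unfolding q p q_def[symmetric] p_def[symmetric]
    by (elim disjE) (simp_all add: algebra_simps)
  have "(u + w - x - y) * (Re q - Re p) = 0" using e[of p] e[of q] by (simp add: algebra_simps)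
  hence s: "u + w = x + y" using ne by auto
  hence pr: "u * w = x * y" using e[of p] by simp
  have "(u - x) * (u - y) = 0" using s pr by algebra
  hence "u = x \<and> w = y \<or> u = y \<and> w = x" using s by auto
  thus "v \<in> (\<lambda>t. tvec y x t) ` {- tq..- tp}"
  proof
    assume "u = x \<and> w = y"
    hence "Re (geod (At x) (At y) r) < Re (geod (At x) (At y) s)" using ne q p by simp
    hence "r < s" using xy by simp
    thus ?thesis using sr by simp
  next
    assume uw: "u = y \<and> w = x"
    have "geod (At x) (At y) (- s) = geod (At x) (At y) tq" "geod (At x) (At y) (- r) = geod (At x) (At y) tp"
      using q p uw by (simp_all only: geod_reverse[of y x] q_def p_def)
    hence "- s = tq" "- r = tp" using geod_inj[OF xy] by blast+
    thus ?thesis using sr v uw by auto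
  qed
qed

lemma geod_exp:
  assumes "x < y"
  shows "geod (At x) (At y) t = Complex ((x + y * exp (2 * t)) / (1 + exp (2 * t))) ((y - x) * exp t / (1 + exp (2 * t)))"
proof -
  have e: "exp (2 * t) = exp t * exp t" by (simp add: exp_double power2_eq_square)
  have p: "1 + exp t * exp t > 0" by (simp add: add_pos_pos)
  have c: "cosh t = (1 + exp t * exp t) / (2 * exp t)"
    by (simp add: cosh_field_def exp_minus field_simps)
  have s: "sinh t = (exp t * exp t - 1) / (2 * exp t)"
    by (simp add: sinh_field_def exp_minus field_simps)
  have th: "tanh t = (exp t * exp t - 1) / (1 + exp t * exp t)"
    unfolding tanh_def c s using p by simp
  have "(x + y) / 2 + (y - x) / 2 * tanh t = (x + y * exp (2 * t)) / (1 + exp (2 * t))"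
    unfolding th e using p by (simp add: divide_simps) (simp add: algebra_simps)
  moreover have "\<bar>y - x\<bar> / 2 / cosh t = (y - x) * exp t / (1 + exp (2 * t))"
    unfolding c e using assms by (simp add: divide_simps)
  ultimately show ?thesis by simp
qed

text \<open>The time at which the geodesic from \<open>x\<close> to \<open>y\<close> meets \<open>[c,d]\<close>, for \<open>x < c < y < d\<close>.\<close>

definition cross_time :: "real \<Rightarrow> real \<Rightarrow> real \<Rightarrow> real \<Rightarrow> real" where
  "cross_time c d x y = ln ((c - x) * (d - x) / ((y - c) * (d - y))) / 2"

lemma gline_Int_gline:
  assumes "x < c" "c < y" "y < d"
  shows "gline x y \<inter> gline c d = {geod (At x) (At y) (cross_time c d x y)}"
proof -
  define K where "K = (c - x) * (d - x) / ((y - c) * (d - y))"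
  have K: "K > 0" using assms by (simp add: K_def)
  have "geod (At x) (At y) t \<in> gline c d \<longleftrightarrow> t = cross_time c d x y" for t
  proof -
    define T where "T = exp (2 * t)"
    have T: "T > 0" by (simp add: T_def)
    have "exp t ^ 2 = T" by (simp add: T_def exp_double)
    moreover have "1 + T \<noteq> 0" using T by simp
    ultimately have "((Re (geod (At x) (At y) t) - c) * (Re (geod (At x) (At y) t) - d) + (Im (geod (At x) (At y) t))\<^sup>2) * (1 + T)\<^sup>2
       = (x + y * T - c * (1 + T)) * (x + y * T - d * (1 + T)) + (y - x)\<^sup>2 * T"
      using assms unfolding geod_exp[of x y, OF less_trans[OF assms(1,2)]] T_def[symmetric]
      by (simp add: divide_simps power_mult_distrib power_divide) (simp add: algebra_simps power2_eq_square)?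
    also have "\<dots> = (1 + T) * ((c - x) * (d - x) - T * ((y - c) * (d - y)))"
      by (simp add: algebra_simps power2_eq_square)
    finally have "(Re (geod (At x) (At y) t) - c) * (Re (geod (At x) (At y) t) - d) + (Im (geod (At x) (At y) t))\<^sup>2 = 0
       \<longleftrightarrow> (c - x) * (d - x) - T * ((y - c) * (d - y)) = 0"
      using \<open>1 + T \<noteq> 0\<close> by (metis mult_eq_0_iff power_eq_0_iff)
    also have "\<dots> \<longleftrightarrow> T = K"
    proof -
      have nz: "(y - c) * (d - y) \<noteq> 0" using assms by simp
      thus ?thesis unfolding K_def nonzero_eq_divide_eq[OF nz] by auto
    qed
    also have "\<dots> \<longleftrightarrow> t = cross_time c d x y"
    proof -
      have "exp (2 * t) = K \<longleftrightarrow> 2 * t = ln K" using K by (metis exp_ln ln_exp)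
      thus ?thesis by (auto simp: T_def cross_time_def K_def[symmetric])
    qed
    finally show ?thesis
      using Im_geod_pos[of x y t] assms by (simp add: gline_iff del: geod.simps)
  qed
  thus ?thesis unfolding gline_def[of x y] by auto
qed

section \<open>Liouville measure in coordinates\<close>

text \<open>The coordinates \<open>(u,w,t)\<close> of a unit vector that is not vertical: \<open>c\<close> is the centre of the half
  circle and \<open>\<rho>\<close> its radius, with the sign of the direction.\<close>

definition tvec_inv :: "complex \<times> complex \<Rightarrow> real \<times> real \<times> real" where
  "tvec_inv = (\<lambda>(z, v). let c = Re z + Im z * Im v / Re v; \<rho> = (Im z)\<^sup>2 / Re v
     in (c - \<rho>, c + \<rho>, artanh (- Im v / Im z)))"

lemma tvec_inv_tvec:
  assumes "u \<noteq> w"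
  shows "tvec_inv (tvec u w t) = (u, w, t)"
proof -
  define g where "g = (w - u) / 2"
  have g: "g \<noteq> 0" using assms by (simp add: g_def)
  have a: "\<bar>w - u\<bar> / 2 = \<bar>g\<bar>" by (simp add: g_def)
  have c: "cosh t \<noteq> 0" by simp
  have "- (- \<bar>g\<bar> * sinh t / (cosh t)\<^sup>2) / (\<bar>g\<bar> / cosh t) = tanh t"
    using g c by (simp add: tanh_def power2_eq_square)
  moreover have "(\<bar>g\<bar> / cosh t)\<^sup>2 / (g / (cosh t)\<^sup>2) = g"
    using g c by (simp add: power2_eq_square)
  moreover have "(\<bar>g\<bar> / cosh t) * (- \<bar>g\<bar> * sinh t / (cosh t)\<^sup>2) / (g / (cosh t)\<^sup>2) = - g * tanh t"
    using g c by (simp add: power2_eq_square tanh_def field_simps)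
  ultimately show ?thesis
    unfolding tvec_inv_def tvec_def geod_vel_At_At geod.simps a g_def[symmetric]
    by (simp add: Let_def artanh_tanh_real) (simp add: g_def field_simps)
qed

lemma tvec_measurable [measurable]:
  "(\<lambda>(u, w, t). tvec u w t) \<in> borel_measurable borel"
  unfolding tvec_def geod_vel_At_At geod.simps
  by (intro borel_measurable_continuous_onI)
     (auto simp: split_beta Complex_eq intro!: continuous_intros)

lemma artanh_measurable [measurable]: "(artanh :: real \<Rightarrow> real) \<in> borel_measurable borel"
  unfolding artanh_def[abs_def] by measurable

lemma tvec_inv_measurable [measurable]: "tvec_inv \<in> borel_measurable borel"
  unfolding tvec_inv_def Let_def borel_prod[symmetric] by measurable

text \<open>An injective Borel parametrisation with a Borel left inverse maps Borel sets to Borel sets, so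
  the Liouville measure of the image can be computed in the coordinates.\<close>

lemma emeasure_Liouville_image:
  assumes R: "R \<in> sets borel" and ne: "\<And>u w t. (u, w, t) \<in> R \<Longrightarrow> u \<noteq> w"
  shows "emeasure Liouville ((\<lambda>(u, w, t). tvec u w t) ` R) =
     (\<integral>\<^sup>+(u, w, t). ennreal (2 / (u - w)\<^sup>2) * indicator R (u, w, t) \<partial>lborel)"
proof -
  define T where "T = (\<lambda>(u, w, t). tvec u w t)"
  have T[measurable]: "T \<in> borel_measurable borel" unfolding T_def by (rule tvec_measurable)
  have inv: "tvec_inv (T r) = r" if "r \<in> R" for r
    using ne that by (cases r) (auto simp: T_def tvec_inv_tvec)
  note [measurable] = R
  have "T ` R = {v. tvec_inv v \<in> R \<and> T (tvec_inv v) = v}"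
    using inv by force
  also have "\<dots> \<in> sets borel" by measurable
  finally have meas: "T ` R \<in> sets borel" .
  have vim: "T -` (T ` R) = R"
  proof (intro equalityI subsetI)
    fix r assume "r \<in> T -` (T ` R)"
    then obtain r' where r': "r' \<in> R" "T r = T r'" by auto
    obtain u w t where r: "r = (u, w, t)" by (cases r)
    obtain u' w' t' where r'_eq: "r' = (u', w', t')" by (cases r')
    hence "u' \<noteq> w'" using ne r' by simp
    hence "Im (fst (T r')) > 0" by (simp add: r'_eq T_def tvec_def)
    hence "Im (fst (T r)) > 0" using r'(2) by simp
    hence "u \<noteq> w" by (auto simp: r T_def tvec_def)
    hence "r = tvec_inv (T r)" by (simp add: r T_def tvec_inv_tvec)
    also have "\<dots> = r'" using inv r' by simp
    finally show "r \<in> R" using r' by simp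
  qed auto
  have d: "(\<lambda>(x, y, t::real). ennreal (2 / (x - y)\<^sup>2)) \<in> borel_measurable (borel :: (real \<times> real \<times> real) measure)"
    unfolding borel_prod[symmetric] by measurable
  have "emeasure Liouville (T ` R) =
      emeasure (density lborel (\<lambda>(x, y, t::real). ennreal (2 / (x - y)\<^sup>2))) (T -` (T ` R) \<inter> space (density lborel (\<lambda>(x, y, t::real). ennreal (2 / (x - y)\<^sup>2))))"
    unfolding Liouville_def T_def[symmetric]
    by (rule emeasure_distr) (use meas T in auto)
  also have "\<dots> = emeasure (density lborel (\<lambda>(x, y, t::real). ennreal (2 / (x - y)\<^sup>2))) R"
    unfolding vim by simp
  also have "\<dots> = (\<integral>\<^sup>+x. (\<lambda>(x, y, t::real). ennreal (2 / (x - y)\<^sup>2)) x * indicator R x \<partial>lborel)"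
    using d R by (subst emeasure_density) auto
  also have "\<dots> = (\<integral>\<^sup>+(u, w, t). ennreal (2 / (u - w)\<^sup>2) * indicator R (u, w, t) \<partial>lborel)"
    by (intro nn_integral_cong) (auto simp: split_beta)
  finally show ?thesis unfolding T_def .
qed

text \<open>For fixed endpoints, the integral over the arc length is the length of the segment.\<close>

lemma emeasure_Liouville_fibred:
  assumes D: "D \<in> sets (borel :: (real \<times> real) measure)"
    and S: "S \<in> borel_measurable borel" and E: "E \<in> borel_measurable borel"
    and SE: "\<And>p. p \<in> D \<Longrightarrow> S p \<le> E p" and ne: "\<And>y x. (y, x) \<in> D \<Longrightarrow> y \<noteq> x"
  shows "emeasure Liouville (\<Union>(y, x)\<in>D. (\<lambda>t. tvec y x t) ` {S (y, x)..E (y, x)}) =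
     (\<integral>\<^sup>+y. \<integral>\<^sup>+x. indicator D (y, x) * ennreal (2 * (E (y, x) - S (y, x)) / (y - x)\<^sup>2) \<partial>lborel \<partial>lborel)"
proof -
  note [measurable] = D[folded borel_prod] S[folded borel_prod] E[folded borel_prod]
  define R where "R = {(y, x, t). (y, x) \<in> D \<and> S (y, x) \<le> t \<and> t \<le> E (y, x)}"
  have "R = {p \<in> space (borel \<Otimes>\<^sub>M borel \<Otimes>\<^sub>M borel). (fst p, fst (snd p)) \<in> D \<and>
      S (fst p, fst (snd p)) \<le> snd (snd p) \<and> snd (snd p) \<le> E (fst p, fst (snd p))}"
    by (auto simp: R_def space_pair_measure)
  also have "\<dots> \<in> sets (borel \<Otimes>\<^sub>M borel \<Otimes>\<^sub>M borel)" by measurable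
  finally have R: "R \<in> sets borel" unfolding borel_prod .
  have im: "(\<Union>(y, x)\<in>D. (\<lambda>t. tvec y x t) ` {S (y, x)..E (y, x)}) = (\<lambda>(u, w, t). tvec u w t) ` R"
    by (force simp: R_def)
  have Rp[measurable]: "R \<in> sets (borel \<Otimes>\<^sub>M borel \<Otimes>\<^sub>M borel)" unfolding borel_prod by (rule R)
  define f :: "real \<times> real \<times> real \<Rightarrow> ennreal"
    where "f = (\<lambda>(u, w, t). ennreal (2 / (u - w)\<^sup>2) * indicator R (u, w, t))"
  have f'[measurable]: "f \<in> borel_measurable (borel \<Otimes>\<^sub>M borel \<Otimes>\<^sub>M borel)"
    unfolding f_def by measurable
  have "f \<in> borel_measurable (borel \<Otimes>\<^sub>M borel)"
    using f' by (simp only: borel_prod)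
  hence f: "f \<in> borel_measurable (lborel \<Otimes>\<^sub>M lborel)"
    by (simp cong: measurable_cong_sets del: borel_prod)
  have "emeasure Liouville ((\<lambda>(u, w, t). tvec u w t) ` R) =
     (\<integral>\<^sup>+(u, w, t). ennreal (2 / (u - w)\<^sup>2) * indicator R (u, w, t) \<partial>lborel)"
    by (rule emeasure_Liouville_image[OF R]) (auto simp: R_def dest: ne)
  also have "\<dots> = (\<integral>\<^sup>+y. \<integral>\<^sup>+p. f (y, p) \<partial>lborel \<partial>lborel)"
    unfolding f_def[symmetric] using lborel.nn_integral_fst[OF f] by (simp add: lborel_prod)
  also have "\<dots> = (\<integral>\<^sup>+y. \<integral>\<^sup>+x. \<integral>\<^sup>+t. f (y, x, t) \<partial>lborel \<partial>lborel \<partial>lborel)"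
  proof (intro nn_integral_cong)
    fix y :: real
    have "(\<lambda>p. f (y, p)) \<in> borel_measurable (lborel \<Otimes>\<^sub>M lborel)"
      using f' by measurable
    from lborel.nn_integral_fst[OF this]
    show "(\<integral>\<^sup>+p. f (y, p) \<partial>lborel) = (\<integral>\<^sup>+x. \<integral>\<^sup>+t. f (y, x, t) \<partial>lborel \<partial>lborel)"
      by (simp add: lborel_prod)
  qed
  also have "\<dots> = (\<integral>\<^sup>+y. \<integral>\<^sup>+x. \<integral>\<^sup>+t. ennreal (2 / (y - x)\<^sup>2) * indicator R (y, x, t) \<partial>lborel \<partial>lborel \<partial>lborel)"
    unfolding f_def by simp
  also have "\<dots> = (\<integral>\<^sup>+y. \<integral>\<^sup>+x. indicator D (y, x) * ennreal (2 * (E (y, x) - S (y, x)) / (y - x)\<^sup>2) \<partial>lborel \<partial>lborel)"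
  proof (intro nn_integral_cong)
    fix y x :: real
    have "(\<integral>\<^sup>+t. ennreal (2 / (y - x)\<^sup>2) * indicator R (y, x, t) \<partial>lborel) =
       (\<integral>\<^sup>+t. ennreal (2 / (y - x)\<^sup>2) * indicator D (y, x) * indicator {S (y, x)..E (y, x)} t \<partial>lborel)"
      by (intro nn_integral_cong) (auto simp: R_def indicator_def)
    also have "\<dots> = ennreal (2 / (y - x)\<^sup>2) * indicator D (y, x) * emeasure lborel {S (y, x)..E (y, x)}"
      by (subst nn_integral_cmult_indicator) auto
    also have "\<dots> = indicator D (y, x) * ennreal (2 * (E (y, x) - S (y, x)) / (y - x)\<^sup>2)"
      using SE[of "(y, x)"] by (auto simp: indicator_def ennreal_mult[symmetric])
    finally show "(\<integral>\<^sup>+t. ennreal (2 / (y - x)\<^sup>2) * indicator R (y, x, t) \<partial>lborel) =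
      indicator D (y, x) * ennreal (2 * (E (y, x) - S (y, x)) / (y - x)\<^sup>2)" .
  qed
  finally show ?thesis unfolding im .
qed


section \<open>Integrals of nonnegative derivatives\<close>

text \<open>The fundamental theorem for nonnegative integrands, in a form that yields both the integral and
  the sign of the difference of the boundary values.\<close>

lemma nn_integral_FTC_einterval:
  fixes f F :: "real \<Rightarrow> real" and a b :: ereal
  assumes "a < b"
    and F: "\<And>x. a < ereal x \<Longrightarrow> ereal x < b \<Longrightarrow> (F has_field_derivative f x) (at x)"
    and f: "\<And>x. a < ereal x \<Longrightarrow> ereal x < b \<Longrightarrow> isCont f x"
    and nonneg: "\<And>x. a < ereal x \<Longrightarrow> ereal x < b \<Longrightarrow> 0 \<le> f x"
    and A: "((F \<circ> real_of_ereal) \<longlongrightarrow> A) (at_right a)"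
    and B: "((F \<circ> real_of_ereal) \<longlongrightarrow> B) (at_left b)"
  shows "(\<integral>\<^sup>+x. indicator (einterval a b) x * ennreal (f x) \<partial>lborel) = ennreal (B - A)" "A \<le> B"
proof -
  note FTC = interval_integral_FTC_nonneg[OF \<open>a < b\<close> F f _ A B]
  have int: "set_integrable lborel (einterval a b) f"
    by (rule FTC(1)) (use nonneg in auto)
  have eq: "(LBINT x=a..b. f x) = B - A"
    by (rule FTC(2)) (use nonneg in auto)
  have nn: "AE x in lborel. 0 \<le> indicator (einterval a b) x *\<^sub>R f x"
    using nonneg by (auto simp: indicator_def einterval_def)
  have "(\<integral>\<^sup>+x. indicator (einterval a b) x * ennreal (f x) \<partial>lborel) =
      (\<integral>\<^sup>+x. ennreal (indicator (einterval a b) x *\<^sub>R f x) \<partial>lborel)"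
    by (intro nn_integral_cong) (auto simp: indicator_def)
  also have "\<dots> = ennreal (\<integral>x. indicator (einterval a b) x *\<^sub>R f x \<partial>lborel)"
    by (rule nn_integral_eq_integral) (use int nn in \<open>auto simp: set_integrable_def\<close>)
  also have "(\<integral>x. indicator (einterval a b) x *\<^sub>R f x \<partial>lborel) = B - A"
    using eq \<open>a < b\<close> by (simp add: interval_lebesgue_integral_def set_lebesgue_integral_def less_imp_le)
  finally show "(\<integral>\<^sup>+x. indicator (einterval a b) x * ennreal (f x) \<partial>lborel) = ennreal (B - A)" .
  have "0 \<le> (\<integral>x. indicator (einterval a b) x *\<^sub>R f x \<partial>lborel)"
    by (rule integral_nonneg_AE) (rule nn)
  thus "A \<le> B"
    using eq \<open>a < b\<close> by (simp add: interval_lebesgue_integral_def set_lebesgue_integral_def less_imp_le)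
qed

lemma nn_integral_FTC_Ioo:
  fixes f F :: "real \<Rightarrow> real"
  assumes "a < b" "continuous_on {a..b} F"
    and F: "\<And>x. a < x \<Longrightarrow> x < b \<Longrightarrow> (F has_field_derivative f x) (at x)"
    and nonneg: "\<And>x. a < x \<Longrightarrow> x < b \<Longrightarrow> 0 \<le> f x"
  shows "(\<integral>\<^sup>+x. indicator {a<..<b} x * ennreal (f x) \<partial>lborel) = ennreal (F b - F a)" "F a \<le> F b"
proof -
  have "(f has_integral (F b - F a)) {a..b}"
    by (rule fundamental_theorem_of_calculus_interior)
       (use assms in \<open>auto simp: has_real_derivative_iff_has_vector_derivative\<close>)
  hence I: "(f has_integral (F b - F a)) {a<..<b}" by (simp add: has_integral_Icc_iff_Ioo)
  show "(\<integral>\<^sup>+x. indicator {a<..<b} x * ennreal (f x) \<partial>lborel) = ennreal (F b - F a)"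
    using nn_integral_has_integral_lebesgue'[OF _ I] nonneg by (simp add: mult.commute)
  have "0 \<le> F b - F a"
    by (rule has_integral_nonneg[OF I]) (use nonneg in auto)
  thus "F a \<le> F b" by simp
qed

section \<open>The Rogers dilogarithm on the unit interval\<close>

lemma Im_integral_eq_0:
  assumes "\<And>t. t \<in> S \<Longrightarrow> Im (f t) = 0"
  shows "Im (integral S f) = 0"
proof (cases "f integrable_on S")
  case True
  have "((Im \<circ> f) has_integral Im (integral S f)) S"
    by (rule has_integral_linear[OF integrable_integral[OF True] bounded_linear_Im])
  moreover have "((Im \<circ> f) has_integral 0) S"
    by (rule has_integral_is_0) (use assms in auto)
  ultimately show ?thesis by (rule has_integral_unique)
qed (simp add: not_integrable_integral)

lemma Rogers_L_of_real:
  assumes "0 < u" "u < 1"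
  shows "Im (Rogers_L (of_real u)) = 0"
proof -
  have *: "Im (Ln (1 - of_real t * of_real u) / of_real t) = 0" if "t \<in> {0..1}" for t
  proof -
    have "t * u \<le> 1 * u" by (rule mult_right_mono) (use that assms in auto)
    hence "t * u < 1" using assms by linarith
    hence "Ln (of_real (1 - t * u)) = of_real (ln (1 - t * u))"
      by (subst Ln_of_real) auto
    thus ?thesis by (simp add: of_real_divide[symmetric] del: of_real_divide)
  qed
  have "Im (Li2 (of_real u)) = 0"
    unfolding Li2_def uminus_complex.sel neg_equal_0_iff_equal by (intro Im_integral_eq_0 *)
  moreover have "Ln (of_real u) = of_real (ln u)" "Ln (1 - of_real u) = of_real (ln (1 - u))"
    using assms Ln_of_real[of u] Ln_of_real[of "1 - u"] by simp_all
  ultimately show ?thesis by (simp add: Rogers_L_def)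
qed

lemma Re_Rogers_L_has_real_derivative:
  assumes "0 < u" "u < 1"
  shows "((\<lambda>u. Re (Rogers_L (of_real u))) has_real_derivative - (ln (1 - u) / u + ln u / (1 - u)) / 2) (at u)"
proof -
  have "of_real u \<in> Rogers_dom" using assms by (simp add: Rogers_dom_def)
  from has_field_derivative_Re[OF has_vector_derivative_real_field[OF Rogers_L_has_field_derivative[OF this]]]
  have D: "((\<lambda>u. Re (Rogers_L (of_real u))) has_real_derivative Re (Rogers_D (of_real u))) (at u)" .
  have Ln: "Ln (of_real u) = of_real (ln u)" "Ln (1 - of_real u) = of_real (ln (1 - u))"
    using assms Ln_of_real[of u] Ln_of_real[of "1 - u"] by simp_all
  have "Rogers_D (of_real u) = of_real (- (ln (1 - u) / u + ln u / (1 - u)) / 2)"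
    unfolding Rogers_D_def Ln by simp
  with D show ?thesis by (simp only: Re_complex_of_real)
qed

lemma isCont_Re_Rogers_L:
  assumes "0 \<le> u" "u < 1"
  shows "isCont (\<lambda>u. Re (Rogers_L (of_real u))) u"
proof (cases "u = 0")
  case True
  have "isCont (\<lambda>u::real. Re (Rogers_L (of_real u))) 0"
  proof (rule isCont_Re, rule isCont_o2[where g = Rogers_L])
    show "isCont (complex_of_real) 0" by (intro continuous_intros)
  qed (simp add: isCont_Rogers_L_0)
  thus ?thesis using True by simp
next
  case False
  with assms have "0 < u" by simp
  from DERIV_isCont[OF Re_Rogers_L_has_real_derivative[OF this assms(2)]] show ?thesis .
qed

section \<open>Lassos around a cusp\<close>

lemma highest_point_iff:
  assumes "x < y"
  shows "p \<in> gline x y \<and> (\<forall>z\<in>gline x y. Im z \<le> Im p) \<longleftrightarrow> p = geod (At x) (At y) 0"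
proof -
  have le: "Im (geod (At x) (At y) t) \<le> Im (geod (At x) (At y) 0)" for t
  proof -
    have "(y - x) / 2 / cosh t \<le> (y - x) / 2 / 1"
      by (rule divide_left_mono) (use assms cosh_real_ge_1[of t] in auto)
    thus ?thesis using assms by simp
  qed
  have "t = 0" if "Im (geod (At x) (At y) 0) \<le> Im (geod (At x) (At y) t)" for t
  proof -
    have "cosh t \<le> 1" using that assms by (simp add: divide_simps split: if_splits)
    thus ?thesis using cosh_real_ge_1[of t] by (simp flip: cosh_real_one_iff)
  qed
  thus ?thesis using le unfolding gline_def by (auto simp del: geod.simps) 
qed

text \<open>Pairs of endpoints \<open>(y,x)\<close> of the geodesics \<open>[x,y]\<close> that carry lassos around the cusp, where
  \<open>d = 2 + 2 a\<close>.\<close>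

definition cusp_domain :: "real \<Rightarrow> (real \<times> real) set" where
  "cusp_domain d = {(y, x). x < 0 \<and> 2 < y \<and> y < d}"

text \<open>The highest point comes before the intersection with \<open>[2,d]\<close> on the way from \<open>x\<close> to \<open>y\<close>.\<close>

lemma cross_time_2_pos:
  assumes "x < 0" "2 < y" "y < d" "d < 4"
  shows "0 < cross_time 2 d x y"
proof -
  have "(y - 2) * (d - y) < (2 - x) * (d - x)"
    by (rule mult_strict_mono) (use assms in auto)
  thus ?thesis using assms by (simp add: cross_time_def)
qed

lemma cusp_lasso_vectors_eq:
  assumes a: "0 < a" "a < 1"
  shows "cusp_lasso_vectors a = (\<Union>(y, x)\<in>cusp_domain (2 + 2 * a).
     (\<lambda>t. tvec y x t) ` {- cross_time 2 (2 + 2 * a) x y..0})"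
proof -
  define d where "d = 2 + 2 * a"
  define Q where "Q = (\<lambda>x y. geod (At x) (At y) (cross_time 2 d x y))"
  have "q \<in> gline x y \<inter> gline 2 d \<and> p \<in> gline x y \<and> (\<forall>z\<in>gline x y. Im z \<le> Im p)
      \<longleftrightarrow> q = Q x y \<and> p = geod (At x) (At y) 0" if "x < 0" "2 < y" "y < d" for x y q p
    using that highest_point_iff[of x y p] unfolding Q_def
    by (subst gline_Int_gline) (auto simp del: geod.simps)
  hence "cusp_lasso_vectors a = \<Union> {seg_vectors q p |x y q p.
      x < 0 \<and> 2 < y \<and> y < d \<and> q = Q x y \<and> p = geod (At x) (At y) 0}"
    unfolding cusp_lasso_vectors_def d_def[symmetric]
    by (intro arg_cong[of _ _ Union] Collect_cong ex_cong1) (intro conj_cong[OF refl], blast)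
  also have "\<dots> = (\<Union>(y, x)\<in>cusp_domain d. seg_vectors (Q x y) (geod (At x) (At y) 0))"
    by (auto simp: cusp_domain_def simp del: geod.simps)
  also have "\<dots> = (\<Union>(y, x)\<in>cusp_domain d. (\<lambda>t. tvec y x t) ` {- cross_time 2 d x y..0})"
  proof (rule SUP_cong[OF refl], clarify)
    fix y x assume "(y, x) \<in> cusp_domain d"
    hence *: "x < 0" "2 < y" "y < d" by (auto simp: cusp_domain_def)
    show "seg_vectors (Q x y) (geod (At x) (At y) 0) = (\<lambda>t. tvec y x t) ` {- cross_time 2 d x y..0}"
      unfolding Q_def
      by (subst seg_vectors_geod) (use * a cross_time_2_pos[of x y d] in \<open>auto simp: d_def\<close>)
  qed
  finally show ?thesis unfolding d_def .
qed

lemma tendsto_ln_div_at_bot: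
  "((\<lambda>x::real. ln (p - x) / (x - q)) \<longlongrightarrow> 0) at_bot"
  "((\<lambda>x::real. ln (p - x) - ln (q - x)) \<longlongrightarrow> 0) at_bot"
proof -
  have lim: "filterlim (\<lambda>x::real. r - x) at_top at_bot" for r
    unfolding filterlim_at_bot_mirror
    by (simp add: filterlim_tendsto_add_at_top[OF tendsto_const filterlim_ident])
  have ratio: "((\<lambda>x. (p - x) / (q - x)) \<longlongrightarrow> 1) at_bot"
  proof -
    have "((\<lambda>x. 1 + (p - q) / (q - x)) \<longlongrightarrow> 1 + 0) at_bot"
      by (intro tendsto_add tendsto_const tendsto_divide_0[OF tendsto_const] 
            filterlim_at_top_imp_at_infinity lim)
    moreover have "eventually (\<lambda>x. 1 + (p - q) / (q - x) = (p - x) / (q - x)) at_bot"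
      using eventually_gt_at_bot[of q] by eventually_elim (auto simp: field_simps)
    ultimately show ?thesis by (simp add: tendsto_cong)
  qed
  have "((\<lambda>x. ln (p - x) / (p - x)) \<longlongrightarrow> 0) at_bot"
    by (rule filterlim_compose[OF ln_x_over_x_tendsto_0 lim])
  from tendsto_minus[OF tendsto_mult[OF this ratio]]
  have "((\<lambda>x. - (ln (p - x) / (p - x) * ((p - x) / (q - x)))) \<longlongrightarrow> 0) at_bot" by simp
  moreover have "eventually (\<lambda>x. - (ln (p - x) / (p - x) * ((p - x) / (q - x))) = ln (p - x) / (x - q)) at_bot"
    using eventually_gt_at_bot[of "min p q"]
  proof eventually_elim
    case (elim x)
    hence "ln (p - x) / (p - x) * ((p - x) / (q - x)) = ln (p - x) / (q - x)" by simp
    thus ?case by (metis minus_diff_eq minus_divide_right)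
  qed
  ultimately show "((\<lambda>x::real. ln (p - x) / (x - q)) \<longlongrightarrow> 0) at_bot"
    by (rule Lim_transform_eventually)
  have "((\<lambda>x. ln ((p - x) / (q - x))) \<longlongrightarrow> ln 1) at_bot"
    by (intro tendsto_ln ratio) simp
  moreover have "eventually (\<lambda>x. ln ((p - x) / (q - x)) = ln (p - x) - ln (q - x)) at_bot"
    using eventually_gt_at_bot[of "min p q"]
    by eventually_elim (auto simp: ln_div)
  ultimately show "((\<lambda>x::real. ln (p - x) - ln (q - x)) \<longlongrightarrow> 0) at_bot"
    by (simp add: tendsto_cong)
qed

text \<open>The integral over \<open>x\<close>, for fixed \<open>y\<close>, of the segment length against the Liouville density.\<close>

definition cusp_inner :: "real \<Rightarrow> real \<Rightarrow> real" where
  "cusp_inner d y = (ln 2 + ln d - ln ((y - 2) * (d - y))) / y + (ln y - ln 2) / (y - 2) + (ln d - ln y) / (d - y)"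

lemma cusp_inner_integral:
  assumes y: "2 < y" "y < d" and d: "d < 4"
  shows "(\<integral>\<^sup>+x. indicator {..<0} x * ennreal (2 * cross_time 2 d x y / (y - x)\<^sup>2) \<partial>lborel) = ennreal (cusp_inner d y)"
    and "0 \<le> cusp_inner d y"
proof -
  define K where "K = (y - 2) * (d - y)"
  have K: "K > 0" using y by (simp add: K_def)
  define F where "F = (\<lambda>x. - ((ln (2 - x) + ln (d - x) - ln K) / (x - y)) +
     (ln (y - x) - ln (2 - x)) / (y - 2) + (ln (d - x) - ln (y - x)) / (d - y))"
  define f where "f = (\<lambda>x. (ln (2 - x) + ln (d - x) - ln K) / (y - x)\<^sup>2)"
  have f_eq: "2 * cross_time 2 d x y / (y - x)\<^sup>2 = f x" if "x < 0" for x
  proof -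
    have "ln ((2 - x) * (d - x) / K) = ln (2 - x) + ln (d - x) - ln K"
      using that y K by (subst ln_div, simp, simp, subst ln_mult) auto
    hence "2 * cross_time 2 d x y = ln (2 - x) + ln (d - x) - ln K"
      unfolding cross_time_def K_def[symmetric] by simp
    thus ?thesis unfolding f_def by (simp only:)
  qed
  have deriv: "(F has_field_derivative f x) (at x)" if "x < 0" for x
  proof -
    define L where "L = ln (2 - x) + ln (d - x) - ln K"
    have nz: "2 - x \<noteq> 0" "d - x \<noteq> 0" "y - x \<noteq> 0" "x - y \<noteq> 0" "y - 2 \<noteq> 0" "d - y \<noteq> 0"
      using that y by auto
    have "((\<lambda>x. ln (2 - x) + ln (d - x) - ln K) has_field_derivative - 1 / (2 - x) + - 1 / (d - x)) (at x)"
      using that y by (auto intro!: derivative_eq_intros simp: divide_inverse)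
    moreover have "((\<lambda>x. x - y) has_field_derivative 1) (at x)"
      by (auto intro!: derivative_eq_intros)
    ultimately have D1: "((\<lambda>x. (ln (2 - x) + ln (d - x) - ln K) / (x - y)) has_field_derivative
        ((- 1 / (2 - x) + - 1 / (d - x)) * (x - y) - L * 1) / ((x - y) * (x - y))) (at x)"
      unfolding L_def by (rule DERIV_divide) (rule nz)
    have D2: "((\<lambda>x. (ln (y - x) - ln (2 - x)) / (y - 2)) has_field_derivative
        (- 1 / (y - x) - - 1 / (2 - x)) / (y - 2)) (at x)"
      using that y by (auto intro!: derivative_eq_intros simp: divide_inverse)
    have D3: "((\<lambda>x. (ln (d - x) - ln (y - x)) / (d - y)) has_field_derivative
        (- 1 / (d - x) - - 1 / (y - x)) / (d - y)) (at x)"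
      using that y by (auto intro!: derivative_eq_intros simp: divide_inverse)
    have "(F has_field_derivative
       - (((- 1 / (2 - x) + - 1 / (d - x)) * (x - y) - L * 1) / ((x - y) * (x - y))) +
       (- 1 / (y - x) - - 1 / (2 - x)) / (y - 2) + (- 1 / (d - x) - - 1 / (y - x)) / (d - y)) (at x)"
      unfolding F_def by (intro DERIV_add DERIV_minus D1 D2 D3)
    moreover have "(- 1 / (y - x) - - 1 / (2 - x)) / (y - 2) = 1 / ((2 - x) * (y - x))"
      using nz by (simp add: divide_simps)
    moreover have "(- 1 / (d - x) - - 1 / (y - x)) / (d - y) = 1 / ((d - x) * (y - x))"
      using nz by (simp add: divide_simps)
    moreover have "- (((- 1 / (2 - x) + - 1 / (d - x)) * (x - y) - L * 1) / ((x - y) * (x - y))) =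
       L / (y - x)\<^sup>2 - 1 / ((2 - x) * (y - x)) - 1 / ((d - x) * (y - x))"
      using nz by (simp add: divide_simps power2_eq_square) (simp add: algebra_simps)
    ultimately have "(F has_field_derivative
       L / (y - x)\<^sup>2 - 1 / ((2 - x) * (y - x)) - 1 / ((d - x) * (y - x)) +
       1 / ((2 - x) * (y - x)) + 1 / ((d - x) * (y - x))) (at x)"
      by (simp only:)
    thus ?thesis unfolding f_def L_def by simp
  qed
  have cont: "isCont f x" if "x < 0" for x
    unfolding f_def using that y by (intro continuous_intros) auto
  have nonneg: "0 \<le> f x" if "x < 0" for x
  proof -
    have "0 \<le> 2 * cross_time 2 d x y / (y - x)\<^sup>2"
      using cross_time_2_pos[of x y d] that y d by simp
    thus ?thesis by (simp only: f_eq[OF that])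
  qed
  have lim_bot: "(F \<longlongrightarrow> 0) at_bot"
  proof -
    have "((\<lambda>x. - (ln (2 - x) / (x - y) + ln (d - x) / (x - y) - ln K / (x - y)) +
       (ln (y - x) - ln (2 - x)) / (y - 2) + (ln (d - x) - ln (y - x)) / (d - y)) \<longlongrightarrow>
        - (0 + 0 - 0) + 0 / (y - 2) + 0 / (d - y)) at_bot"
    proof (intro tendsto_add tendsto_minus tendsto_diff tendsto_ln_div_at_bot tendsto_divide tendsto_const)
      show "((\<lambda>x. ln K / (x - y)) \<longlongrightarrow> 0) at_bot"
        by (rule tendsto_divide_0[OF tendsto_const filterlim_at_bot_imp_at_infinity])
           (use filterlim_tendsto_add_at_bot_iff[OF tendsto_const[of "-y"], of "\<lambda>x. x" at_bot] 
             in \<open>simp add: filterlim_ident\<close>)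
    qed (use y in auto)
    thus ?thesis by (simp add: F_def add_divide_distrib diff_divide_distrib)
  qed
  have lim_0: "(F \<longlongrightarrow> cusp_inner d y) (at_left 0)"
  proof -
    have "isCont F 0" unfolding F_def using y by (intro continuous_intros) auto
    hence "(F \<longlongrightarrow> F 0) (at_left 0)" 
      by (simp add: continuous_at filterlim_at_split)
    moreover have "F 0 = cusp_inner d y"
      unfolding F_def cusp_inner_def K_def by simp
    ultimately show ?thesis by simp
  qed
  have ei: "einterval (- \<infinity>) (ereal 0) = {..<0}" by (auto simp: einterval_def)
  have *: "(\<integral>\<^sup>+x. indicator (einterval (- \<infinity>) (ereal 0)) x * ennreal (f x) \<partial>lborel) = ennreal (cusp_inner d y - 0)"
    "0 \<le> cusp_inner d y"
    by (rule nn_integral_FTC_einterval[of "-\<infinity>" "ereal 0" F f 0 "cusp_inner d y"]; 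
        use deriv cont nonneg lim_bot lim_0 in \<open>auto simp: ereal_tendsto_simps1\<close>)+
  show "0 \<le> cusp_inner d y" by (rule *)
  show "(\<integral>\<^sup>+x. indicator {..<0} x * ennreal (2 * cross_time 2 d x y / (y - x)\<^sup>2) \<partial>lborel) = ennreal (cusp_inner d y)"
    using *(1) unfolding ei
    by (subst nn_integral_cong[where v = "\<lambda>x. indicator {..<0} x * ennreal (f x)"])
       (auto simp: indicator_def f_eq)
qed

text \<open>A primitive is \<open>2 L (1 - 2 / y) - 2 L (1 - y / d)\<close>.\<close>

lemma cusp_outer_integral:
  assumes d: "2 < d" "d < 4"
  shows "(\<integral>\<^sup>+y. indicator {2<..<d} y * ennreal (cusp_inner d y) \<partial>lborel) = ennreal (4 * Re (Rogers_L (of_real (1 - 2 / d))))"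
    and "0 \<le> Re (Rogers_L (of_real (1 - 2 / d)))"
proof -
  define R where "R = (\<lambda>u. Re (Rogers_L (of_real u)))"
  define P where "P = (\<lambda>y. 2 * R (1 - 2 / y) - 2 * R (1 - y / d))"
  have cont: "continuous_on {2..d} P"
  proof (intro continuous_at_imp_continuous_on ballI)
    fix y assume y: "y \<in> {2..d}"
    have R: "isCont R (1 - 2 / y)" "isCont R (1 - y / d)"
      unfolding R_def by (rule isCont_Re_Rogers_L; use y d in \<open>simp add: field_simps\<close>)+
    have i: "isCont (\<lambda>y. 1 - 2 / y) y" "isCont (\<lambda>y. 1 - y / d) y"
      using y d by (auto intro!: continuous_intros)
    from isCont_o2[OF i(1) R(1)] isCont_o2[OF i(2) R(2)]
    show "isCont P y" unfolding P_def by (intro continuous_intros)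
  qed
  have deriv: "(P has_field_derivative cusp_inner d y) (at y)" if y: "2 < y" "y < d" for y
  proof -
    have R: "(R has_field_derivative - (ln (1 - u) / u + ln u / (1 - u)) / 2) (at u)" if "0 < u" "u < 1" for u
      unfolding R_def by (rule Re_Rogers_L_has_real_derivative) fact+
    have u: "0 < 1 - 2 / y" "1 - 2 / y < 1" "0 < 1 - y / d" "1 - y / d < 1"
      using y by (simp_all add: field_simps)
    have i1: "((\<lambda>y. 1 - 2 / y) has_field_derivative 2 / y\<^sup>2) (at y)"
      using y by (auto intro!: derivative_eq_intros simp: power2_eq_square)
    have i2: "((\<lambda>y. 1 - y / d) has_field_derivative - 1 / d) (at y)"
      using y by (auto intro!: derivative_eq_intros simp: divide_inverse)
    have 1: "(P has_field_derivative
       2 * (- (ln (1 - (1 - 2 / y)) / (1 - 2 / y) + ln (1 - 2 / y) / (1 - (1 - 2 / y))) / 2 * (2 / y\<^sup>2)) -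
       2 * (- (ln (1 - (1 - y / d)) / (1 - y / d) + ln (1 - y / d) / (1 - (1 - y / d))) / 2 * (- 1 / d))) (at y)"
      unfolding P_def
      by (intro DERIV_diff DERIV_cmult DERIV_chain2[OF R[OF u(1,2)] i1] DERIV_chain2[OF R[OF u(3,4)] i2])
    have l: "1 - 2 / y = (y - 2) / y" "1 - (1 - 2 / y) = 2 / y" "1 - y / d = (d - y) / d" "1 - (1 - y / d) = y / d"
      using y by (auto simp: field_simps)
    have lns: "ln ((y - 2) / y) = ln (y - 2) - ln y" "ln (2 / y) = ln 2 - ln y"
       "ln ((d - y) / d) = ln (d - y) - ln d" "ln (y / d) = ln y - ln d" "ln ((y - 2) * (d - y)) = ln (y - 2) + ln (d - y)"
      using y by (simp_all add: ln_div ln_mult)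
    have alg: "2 * (- ((l2 - ly) / ((y - 2) / y) + (ly2 - ly) / (2 / y)) / 2 * (2 / y\<^sup>2)) -
       2 * (- ((ly - ld) / ((d - y) / d) + (ldy - ld) / (y / d)) / 2 * (- 1 / d)) =
       (l2 + ld - (ly2 + ldy)) / y + (ly - l2) / (y - 2) + (ld - ly) / (d - y)" for l2 ly ly2 ld ldy :: real
      using y by (simp add: divide_simps power2_eq_square) (simp add: algebra_simps)
    show ?thesis using 1 unfolding l(2,4) unfolding l(1,3) lns alg cusp_inner_def .
  qed
  have *: "(\<integral>\<^sup>+y. indicator {2<..<d} y * ennreal (cusp_inner d y) \<partial>lborel) = ennreal (P d - P 2)" "P 2 \<le> P d"
    by (rule nn_integral_FTC_Ioo[of 2 d P "cusp_inner d"]; use d cont deriv cusp_inner_integral(2) in auto)+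
  have "P d = 2 * R (1 - 2 / d)" "P 2 = - 2 * R (1 - 2 / d)"
    using d by (simp_all add: P_def R_def)
  with * show "(\<integral>\<^sup>+y. indicator {2<..<d} y * ennreal (cusp_inner d y) \<partial>lborel) = ennreal (4 * Re (Rogers_L (of_real (1 - 2 / d))))"
    and "0 \<le> Re (Rogers_L (of_real (1 - 2 / d)))"
    unfolding R_def by simp_all
qed

lemma cross_time_measurable [measurable]:
  "(\<lambda>p. cross_time c d (snd p) (fst p)) \<in> borel_measurable borel"
  unfolding cross_time_def borel_prod[symmetric] by measurable

lemma measure_cusp_lasso_vectors:
  assumes a: "0 < a" "a < 1"
  shows "of_real (measure Liouville (cusp_lasso_vectors a)) = 4 * Rogers_L (of_real (a / (1 + a)))"
proof -
  define d where "d = 2 + 2 * a"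
  have d: "2 < d" "d < 4" using a by (auto simp: d_def)
  have D: "cusp_domain d \<in> sets borel"
  proof -
    have "cusp_domain d = {p. snd p < 0 \<and> 2 < fst p \<and> fst p < d}" by (auto simp: cusp_domain_def)
    also have "open \<dots>" by (intro open_Collect_conj open_Collect_less continuous_intros)
    ultimately show ?thesis by simp
  qed
  have "emeasure Liouville (cusp_lasso_vectors a) = 
     emeasure Liouville (\<Union>(y, x)\<in>cusp_domain d. (\<lambda>t. tvec y x t) `
       {(\<lambda>p. - cross_time 2 d (snd p) (fst p)) (y, x)..(\<lambda>p. 0) (y, x)})"
    unfolding cusp_lasso_vectors_eq[OF a] d_def by simp
  also have "\<dots> = (\<integral>\<^sup>+y. \<integral>\<^sup>+x. indicator (cusp_domain d) (y, x) *
      ennreal (2 * ((\<lambda>p. 0) (y, x) - (\<lambda>p. - cross_time 2 d (snd p) (fst p)) (y, x)) / (y - x)\<^sup>2) \<partial>lborel \<partial>lborel)"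
    by (rule emeasure_Liouville_fibred[OF D])
       (use d cross_time_2_pos in \<open>auto simp: cusp_domain_def less_imp_le\<close>)
  also have "\<dots> = (\<integral>\<^sup>+y. indicator {2<..<d} y * (\<integral>\<^sup>+x. indicator {..<0} x *
      ennreal (2 * cross_time 2 d x y / (y - x)\<^sup>2) \<partial>lborel) \<partial>lborel)"
    by (intro nn_integral_cong) (auto simp: indicator_def cusp_domain_def intro!: nn_integral_cong)
  also have "\<dots> = (\<integral>\<^sup>+y. indicator {2<..<d} y * ennreal (cusp_inner d y) \<partial>lborel)"
    by (intro nn_integral_cong) (use d cusp_inner_integral in \<open>auto simp: indicator_def\<close>)
  also have "\<dots> = ennreal (4 * Re (Rogers_L (of_real (1 - 2 / d))))"
    by (rule cusp_outer_integral[OF d])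
  also have "1 - 2 / d = a / (1 + a)" using a by (simp add: d_def field_simps)
  finally have "measure Liouville (cusp_lasso_vectors a) = 4 * Re (Rogers_L (of_real (a / (1 + a))))"
    using cusp_outer_integral(2)[OF d] \<open>1 - 2 / d = a / (1 + a)\<close> by (simp add: measure_def)
  thus ?thesis using Rogers_L_of_real[of "a / (1 + a)"] a by (simp add: complex_eq_iff)
qed


section \<open>Rogers dilogarithms of cross ratios\<close>

text \<open>The cross ratio of \<open>x, y\<close> with respect to \<open>c, p\<close>, normalised to vanish at \<open>y = c\<close>. With
  \<open>p = \<i>\<close>, the segment of \<open>[x,y]\<close> between \<open>[a,b]\<close> and the point closest to \<open>\<i>\<close> has length \<open>- 1/2\<close> times
  the logarithm of the product of the moduli for \<open>c = a\<close> and \<open>c = b\<close>.\<close>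

definition cross_ratio :: "complex \<Rightarrow> complex \<Rightarrow> complex \<Rightarrow> complex \<Rightarrow> complex" where
  "cross_ratio c p x y = (y - c) * (x - p) / ((x - c) * (y - p))"

text \<open>The partial derivative with respect to \<open>y\<close> of \<open>- 2 L (cross_ratio c p x y)\<close>.\<close>

definition cr_partial :: "complex \<Rightarrow> complex \<Rightarrow> complex \<Rightarrow> complex \<Rightarrow> complex" where
  "cr_partial c p x y = Ln (1 - cross_ratio c p x y) * (1 / (y - c) - 1 / (y - p)) +
     Ln (cross_ratio c p x y) * (1 / (y - p) - 1 / (y - x))"

lemma one_minus_cross_ratio:
  assumes "x \<noteq> c" "y \<noteq> p"
  shows "1 - cross_ratio c p x y = (x - y) * (c - p) / ((x - c) * (y - p))"
proof -
  have "(x - c) * (y - p) \<noteq> 0" using assms by simp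
  hence "1 - cross_ratio c p x y = ((x - c) * (y - p) - (y - c) * (x - p)) / ((x - c) * (y - p))"
    unfolding cross_ratio_def by (simp add: diff_divide_distrib)
  also have "(x - c) * (y - p) - (y - c) * (x - p) = (x - y) * (c - p)" by (simp add: algebra_simps)
  finally show ?thesis .
qed

lemma cross_ratio_deriv_x:
  assumes "x \<noteq> c" "y \<noteq> p"
  shows "((\<lambda>x. cross_ratio c p x y) has_field_derivative (y - c) * (p - c) / ((y - p) * (x - c)\<^sup>2)) (at x)"
proof -
  have 1: "((\<lambda>x. (x - p) / (x - c)) has_field_derivative (1 * (x - c) - (x - p) * 1) / ((x - c) * (x - c))) (at x)"
    using assms by (intro DERIV_divide) (auto intro!: derivative_eq_intros)
  have "((\<lambda>x. (y - c) / (y - p) * ((x - p) / (x - c))) has_field_derivative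
      (y - c) / (y - p) * ((1 * (x - c) - (x - p) * 1) / ((x - c) * (x - c)))) (at x)"
    by (rule DERIV_cmult[OF 1])
  moreover have "(\<lambda>x. (y - c) / (y - p) * ((x - p) / (x - c))) = (\<lambda>x. cross_ratio c p x y)"
    by (simp add: cross_ratio_def fun_eq_iff)
  moreover have "(y - c) / (y - p) * ((1 * (x - c) - (x - p) * 1) / ((x - c) * (x - c))) =
      (y - c) * (p - c) / ((y - p) * (x - c)\<^sup>2)"
    by (simp add: power2_eq_square)
  ultimately show ?thesis by (simp only:)
qed

lemma cross_ratio_deriv_y:
  assumes "x \<noteq> c" "y \<noteq> p"
  shows "((\<lambda>y. cross_ratio c p x y) has_field_derivative (x - p) * (c - p) / ((x - c) * (y - p)\<^sup>2)) (at y)"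
proof -
  have 1: "((\<lambda>y. (y - c) / (y - p)) has_field_derivative (1 * (y - p) - (y - c) * 1) / ((y - p) * (y - p))) (at y)"
    using assms by (intro DERIV_divide) (auto intro!: derivative_eq_intros)
  have "((\<lambda>y. (x - p) / (x - c) * ((y - c) / (y - p))) has_field_derivative
      (x - p) / (x - c) * ((1 * (y - p) - (y - c) * 1) / ((y - p) * (y - p)))) (at y)"
    by (rule DERIV_cmult[OF 1])
  moreover have "(\<lambda>y. (x - p) / (x - c) * ((y - c) / (y - p))) = (\<lambda>y. cross_ratio c p x y)"
    by (simp add: cross_ratio_def fun_eq_iff mult.commute)
  moreover have "(x - p) / (x - c) * ((1 * (y - p) - (y - c) * 1) / ((y - p) * (y - p))) =
      (x - p) * (c - p) / ((x - c) * (y - p)\<^sup>2)"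
    by (simp add: power2_eq_square)
  ultimately show ?thesis by (simp only:)
qed

text \<open>The mixed second derivative of \<open>- 2 L (cross_ratio c p x y)\<close> is the logarithm of the cross ratio
  times the density \<open>- 1 / (y - x)\<^sup>2\<close>: the two contributions from differentiating the logarithms
  cancel.\<close>

lemma cr_partial_deriv_x:
  assumes ne: "x \<noteq> c" "y \<noteq> p" "x \<noteq> y" "c \<noteq> p" "x \<noteq> p" "y \<noteq> c"
    and dom: "cross_ratio c p x y \<in> Rogers_dom"
  shows "((\<lambda>x. cr_partial c p x y) has_field_derivative - Ln (cross_ratio c p x y) / (y - x)\<^sup>2) (at x)"
proof -
  define r where "r = cross_ratio c p x y"
  define r' where "r' = (y - c) * (p - c) / ((y - p) * (x - c)\<^sup>2)"
  have nz: "x - c \<noteq> 0" "y - p \<noteq> 0" "x - y \<noteq> 0" "y - x \<noteq> 0" "c - p \<noteq> 0" "x - p \<noteq> 0" "y - c \<noteq> 0" "p - c \<noteq> 0"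
    using ne by simp_all
  note d = Rogers_domD[OF dom, folded r_def]
  note r_deriv = cross_ratio_deriv_x[OF ne(1,2), folded r'_def]
  have one_minus: "((\<lambda>x. 1 - cross_ratio c p x y) has_field_derivative 0 - r') (at x)"
    by (intro DERIV_diff DERIV_const r_deriv)
  have inv: "((\<lambda>x. 1 / (y - p) - 1 / (y - x)) has_field_derivative - 1 / (y - x)\<^sup>2) (at x)"
    using nz by (auto intro!: derivative_eq_intros simp: power2_eq_square)
  have "((\<lambda>x. cr_partial c p x y) has_field_derivative
     inverse (1 - r) * (0 - r') * (1 / (y - c) - 1 / (y - p)) +
     (inverse r * r' * (1 / (y - p) - 1 / (y - x)) + (- 1 / (y - x)\<^sup>2) * Ln r)) (at x)"
    unfolding cr_partial_def r_def
    by (intro DERIV_add DERIV_mult DERIV_cmult_right inv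
        DERIV_chain2[OF has_field_derivative_Ln one_minus] DERIV_chain2[OF has_field_derivative_Ln r_deriv])
       (use d in \<open>simp_all add: r_def\<close>)
  moreover have "inverse (1 - r) * (0 - r') * (1 / (y - c) - 1 / (y - p)) = (c - p) / ((x - c) * (x - y) * (y - p))"
  proof -
    have "1 / (y - c) - 1 / (y - p) = (c - p) / ((y - c) * (y - p))"
      using nz by (simp add: divide_simps)
    moreover have "inverse (1 - r) * (0 - r') = (y - c) / ((x - c) * (x - y))"
      unfolding r_def one_minus_cross_ratio[OF ne(1,2)] r'_def using nz
      by (simp add: divide_simps power2_eq_square) (simp add: algebra_simps)
    ultimately show ?thesis using nz by simp
  qed
  moreover have "inverse r * r' * (1 / (y - p) - 1 / (y - x)) = - ((c - p) / ((x - c) * (x - y) * (y - p)))"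
  proof -
    have "1 / (y - p) - 1 / (y - x) = (x - p) / ((y - p) * (x - y))"
      using nz by (simp add: divide_simps) (simp add: algebra_simps)
    moreover have "inverse r * r' = - ((c - p) / ((x - c) * (x - p)))"
      unfolding r_def cross_ratio_def r'_def using nz
      by (simp add: divide_simps power2_eq_square) (simp add: algebra_simps)?
    ultimately show ?thesis using nz by simp
  qed
  ultimately have "((\<lambda>x. cr_partial c p x y) has_field_derivative
      (c - p) / ((x - c) * (x - y) * (y - p)) +
      (- ((c - p) / ((x - c) * (x - y) * (y - p))) + - 1 / (y - x)\<^sup>2 * Ln r)) (at x)"
    by (simp only:)
  thus ?thesis by (simp add: r_def)
qed

lemma Rogers_L_cross_ratio_deriv_y:
  assumes ne: "x \<noteq> c" "y \<noteq> p" "x \<noteq> y" "c \<noteq> p" "x \<noteq> p" "y \<noteq> c"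
    and dom: "cross_ratio c p x y \<in> Rogers_dom"
  shows "((\<lambda>y. - 2 * Rogers_L (cross_ratio c p x y)) has_field_derivative cr_partial c p x y) (at y)"
proof -
  define r where "r = cross_ratio c p x y"
  define r' where "r' = (x - p) * (c - p) / ((x - c) * (y - p)\<^sup>2)"
  have nz: "x - c \<noteq> 0" "y - p \<noteq> 0" "x - y \<noteq> 0" "y - x \<noteq> 0" "c - p \<noteq> 0" "x - p \<noteq> 0" "y - c \<noteq> 0" "p - c \<noteq> 0"
    using ne by simp_all
  have "((\<lambda>y. - 2 * Rogers_L (cross_ratio c p x y)) has_field_derivative - 2 * (Rogers_D r * r')) (at y)"
    unfolding r_def r'_def
    by (intro DERIV_cmult DERIV_chain2[OF Rogers_L_has_field_derivative cross_ratio_deriv_y] ne dom)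
  moreover have "- 2 * (Rogers_D r * r') = Ln (1 - r) * (r' / r) + Ln r * (r' / (1 - r))"
    by (simp add: Rogers_D_def algebra_simps)
  moreover have "r' / r = 1 / (y - c) - 1 / (y - p)"
    unfolding r_def cross_ratio_def r'_def using nz
    by (simp add: divide_simps power2_eq_square)
  moreover have "r' / (1 - r) = 1 / (y - p) - 1 / (y - x)"
    unfolding r_def one_minus_cross_ratio[OF ne(1,2)] r'_def using nz
    by (simp add: divide_simps power2_eq_square) (simp add: algebra_simps)?
  ultimately show ?thesis unfolding cr_partial_def r_def by (simp only:)
qed

text \<open>From here on \<open>c, x, y\<close> are points of the real line, and \<open>p\<close> is the cone point \<open>\<i>\<close>.\<close>

abbreviation "cr c x y \<equiv> cross_ratio (complex_of_real c) \<i> (complex_of_real x) (complex_of_real y)"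

lemma cr_eq:
  "cr c x y = of_real ((y - c) / ((x - c) * (1 + y\<^sup>2))) * Complex (1 + x * y) (x - y)"
proof -
  have "1 + y\<^sup>2 \<noteq> 0" by (smt (verit) zero_le_power2)
  hence nz: "complex_of_real (1 + y\<^sup>2) \<noteq> 0"
    by (simp only: of_real_eq_0_iff not_False_eq_True)
  have nz': "of_real y - \<i> \<noteq> 0"
    by (simp add: complex_eq_iff)
  have "Complex (1 + x * y) (x - y) * (of_real y - \<i>) = of_real (1 + y\<^sup>2) * (of_real x - \<i>)"
    by (simp add: complex_eq_iff power2_eq_square algebra_simps)
  hence "(of_real x - \<i>) / (of_real y - \<i>) = of_real (1 / (1 + y\<^sup>2)) * Complex (1 + x * y) (x - y)"
    unfolding of_real_divide using nz nz' by (simp add: divide_simps del: of_real_add)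
  moreover have "cr c x y = of_real ((y - c) / (x - c)) * ((of_real x - \<i>) / (of_real y - \<i>))"
    by (simp add: cross_ratio_def)
  ultimately show ?thesis by simp
qed

text \<open>For distinct real points the cross ratio is never real, so that it stays away from both cuts.\<close>

lemma cr_in_Rogers_dom:
  assumes "x \<noteq> c" "y \<noteq> c" "x \<noteq> y"
  shows "cr c x y \<in> Rogers_dom"
proof -
  have "1 + y\<^sup>2 \<noteq> 0" by (smt (verit) zero_le_power2)
  hence "Im (cr c x y) \<noteq> 0" unfolding cr_eq using assms by simp
  thus ?thesis by (simp add: Rogers_dom_def)
qed

lemma norm_cr:
  "norm (cr c x y) = \<bar>y - c\<bar> * sqrt (1 + x\<^sup>2) / (\<bar>x - c\<bar> * sqrt (1 + y\<^sup>2))"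
proof -
  have "norm (of_real x - \<i>) = sqrt (1 + x\<^sup>2)" for x
    by (simp add: cmod_def add.commute)
  moreover have "norm (complex_of_real x - of_real c) = \<bar>x - c\<bar>" for x
    by (metis norm_of_real of_real_diff)
  ultimately show ?thesis by (simp add: cross_ratio_def norm_mult norm_divide)
qed

text \<open>The real part of \<open>cr_partial\<close> at real points is the primitive in \<open>x\<close> for the inner integral.\<close>

abbreviation "re_partial c x y \<equiv> Re (cr_partial (complex_of_real c) \<i> (complex_of_real x) (complex_of_real y))"

lemma of_real_ne_ii [simp]: "complex_of_real x \<noteq> \<i>"
  by (simp add: complex_eq_iff)

lemma re_partial_deriv_x:
  assumes "x \<noteq> c" "y \<noteq> c" "x \<noteq> y"
  shows "((\<lambda>x. re_partial c x y) has_field_derivative - ln (norm (cr c x y)) / (y - x)\<^sup>2) (at x)"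
proof -
  have dom: "cr c x y \<in> Rogers_dom" by (rule cr_in_Rogers_dom) fact+
  have 1: "((\<lambda>x. cr_partial (of_real c) \<i> x (of_real y)) has_field_derivative
        - Ln (cr c x y) / (of_real y - of_real x)\<^sup>2) (at (of_real x))"
    by (rule cr_partial_deriv_x) (use assms dom of_real_ne_ii[of c] in auto)
  have "- Ln (cr c x y) / (of_real y - of_real x)\<^sup>2 = - Ln (cr c x y) / of_real ((y - x)\<^sup>2)" by simp
  also have "Re \<dots> = - ln (norm (cr c x y)) / (y - x)\<^sup>2"
    using Rogers_domD(2)[OF dom] by (simp del: of_real_power of_real_diff)
  finally show ?thesis
    using has_field_derivative_Re[OF has_vector_derivative_real_field[OF 1]] by (simp only:)
qed

lemma Re_Rogers_L_cr_deriv_y: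
  assumes "x \<noteq> c" "y \<noteq> c" "x \<noteq> y"
  shows "((\<lambda>y. Re (- 2 * Rogers_L (cr c x y))) has_field_derivative re_partial c x y) (at y)"
proof -
  have dom: "cr c x y \<in> Rogers_dom" by (rule cr_in_Rogers_dom) fact+
  have 1: "((\<lambda>y. - 2 * Rogers_L (cross_ratio (of_real c) \<i> (of_real x) y)) has_field_derivative
       cr_partial (of_real c) \<i> (of_real x) (of_real y)) (at (of_real y))"
    by (rule Rogers_L_cross_ratio_deriv_y) (use assms dom of_real_ne_ii[of c] in auto)
  show ?thesis by (rule has_field_derivative_Re[OF has_vector_derivative_real_field[OF 1]])
qed

lemma cr_diagonal [simp]: "cr c x c = 0"
  by (simp add: cross_ratio_def)

lemma isCont_Re_Rogers_L_cr:
  assumes "x \<noteq> c" "x \<noteq> y"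
  shows "isCont (\<lambda>y. Re (- 2 * Rogers_L (cr c x y))) y"
proof (cases "y = c")
  case False
  thus ?thesis using DERIV_isCont[OF Re_Rogers_L_cr_deriv_y[of x c y]] assms by blast
next
  case True
  have "isCont (\<lambda>y. cr c x y) y"
    using assms unfolding cross_ratio_def by (intro continuous_intros) auto
  moreover have "isCont Rogers_L (cr c x y)" using True by (simp add: isCont_Rogers_L_0)
  ultimately have "isCont (\<lambda>y. Rogers_L (cr c x y)) y" by (rule isCont_o2)
  from isCont_Re[OF isCont_mult[OF continuous_const this]] show ?thesis .
qed

section \<open>Chords through the cone point\<close>

text \<open>On the lower boundary \<open>x = - 1 / y\<close> of the domain of integration the chord passes through \<open>\<i>\<close>
  and the cross ratio is \<open>\<i> t\<close> with \<open>t = (y - c) / (1 + c y)\<close>. Composed with \<open>t\<close>, this function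
  is a primitive in \<open>y\<close> of the contribution of that boundary, up to a term from the argument of \<open>\<i> t\<close>
  that has opposite signs for \<open>c = a\<close> and \<open>c = b\<close>. What matters is that it is even in \<open>t\<close>. The argument of \<open>Li2\<close> is \<open>sin\<^sup>2\<close> of \<open>arctan t\<close>.\<close>

definition antipode_primitive :: "real \<Rightarrow> real" where
  "antipode_primitive t = Re (Li2 (of_real (t\<^sup>2 / (1 + t\<^sup>2)))) / 4 - (arctan t)\<^sup>2 / 2"

lemma antipode_primitive_even: "antipode_primitive (- t) = antipode_primitive t"
  by (simp add: antipode_primitive_def arctan_minus)

lemma one_plus_square_pos: "0 < 1 + (t::real)\<^sup>2"
  by (smt (verit) zero_le_power2)

lemma of_real_quot_in_slit: "complex_of_real (t\<^sup>2 / (1 + t\<^sup>2)) \<in> slit"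
  using one_plus_square_pos[of t] by (simp add: slit_def)

lemma isCont_antipodal: "isCont antipode_primitive t"
proof -
  have "isCont (\<lambda>t. complex_of_real (t\<^sup>2 / (1 + t\<^sup>2))) t"
    using one_plus_square_pos[of t] by (intro continuous_intros) auto
  from isCont_o2[OF this isCont_Li2[OF of_real_quot_in_slit]]
  have "isCont (\<lambda>t. Li2 (of_real (t\<^sup>2 / (1 + t\<^sup>2)))) t" .
  from isCont_Re[OF this] show ?thesis
    unfolding antipode_primitive_def[abs_def] by (intro continuous_intros) simp_all
qed

lemma antipode_primitive_deriv:
  assumes "t \<noteq> 0"
  shows "(antipode_primitive has_field_derivative (ln (1 + t\<^sup>2) / (2 * t) - arctan t) / (1 + t\<^sup>2)) (at t)"
proof -
  define s where "s = t\<^sup>2 / (1 + t\<^sup>2)"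
  have p: "0 < 1 + t\<^sup>2" by (rule one_plus_square_pos)
  have s: "s \<noteq> 0" "1 - s = 1 / (1 + t\<^sup>2)" using assms p by (auto simp: s_def field_simps)
  have 1: "(Li2 has_field_derivative - Ln (1 - of_real s) / of_real s) (at (of_real s))"
    using Li2_has_field_derivative[OF of_real_quot_in_slit[of t]] s(1) unfolding s_def[symmetric] by simp
  have "1 - complex_of_real s = of_real (1 / (1 + t\<^sup>2))" using s(2) by (metis of_real_1 of_real_diff)
  hence "Ln (1 - of_real s) = of_real (- ln (1 + t\<^sup>2))"
    using p by (simp add: Ln_of_real ln_div del: of_real_divide of_real_minus)
  hence Re: "Re (- Ln (1 - of_real s) / of_real s) = ln (1 + t\<^sup>2) / s"
    by simp
  have 2: "((\<lambda>s. Re (Li2 (of_real s))) has_field_derivative ln (1 + t\<^sup>2) / s) (at s)"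
    using has_field_derivative_Re[OF has_vector_derivative_real_field[OF 1]] Re by simp
  have 3: "((\<lambda>t. t\<^sup>2 / (1 + t\<^sup>2)) has_field_derivative (2 * t * (1 + t\<^sup>2) - t\<^sup>2 * (2 * t)) / ((1 + t\<^sup>2) * (1 + t\<^sup>2))) (at t)"
  proof (rule DERIV_divide)
    show "((\<lambda>t. t\<^sup>2) has_field_derivative 2 * t) (at t)"
      using DERIV_pow[of 2 t UNIV] by simp
    from DERIV_add[OF DERIV_const this] show "((\<lambda>t. 1 + t\<^sup>2) has_field_derivative 2 * t) (at t)"
      by (simp only: add_0)
    show "1 + t\<^sup>2 \<noteq> 0" using p by simp
  qed
  have 4: "((\<lambda>t. (arctan t)\<^sup>2 / 2) has_field_derivative 2 * arctan t * inverse (1 + t\<^sup>2) / 2) (at t)"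
    using DERIV_cdivide[OF DERIV_power[OF DERIV_arctan[of t], of 2], of 2]
    by (simp add: mult_ac)
  have "(antipode_primitive has_field_derivative
      ln (1 + t\<^sup>2) / s * ((2 * t * (1 + t\<^sup>2) - t\<^sup>2 * (2 * t)) / ((1 + t\<^sup>2) * (1 + t\<^sup>2))) / 4 - 2 * arctan t * inverse (1 + t\<^sup>2) / 2) (at t)"
    unfolding antipode_primitive_def[abs_def]
    by (intro DERIV_diff DERIV_cdivide 4 DERIV_chain2[OF 2[unfolded s_def] 3, folded s_def])
  moreover have "ln (1 + t\<^sup>2) / s * ((2 * t * (1 + t\<^sup>2) - t\<^sup>2 * (2 * t)) / ((1 + t\<^sup>2) * (1 + t\<^sup>2))) / 4 = ln (1 + t\<^sup>2) / (2 * t) / (1 + t\<^sup>2)"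
  proof -
    have "L / (t\<^sup>2 / q) * ((2 * t * q - t\<^sup>2 * (2 * t)) / (q * q)) / 4 = L / (2 * t) / q" 
      if "q = 1 + t\<^sup>2" "q \<noteq> 0" for L q
    proof -
      have "2 * t * q - t\<^sup>2 * (2 * t) = 2 * t" unfolding that(1) by (simp add: algebra_simps)
      hence "(2 * t * q - t\<^sup>2 * (2 * t)) / (q * q) = 2 * t / (q * q)" by (simp only:)
      moreover have "L / (t\<^sup>2 / q) * (2 * t / (q * q)) / 4 = L / (2 * t) / q"
        using assms that(2) by (simp add: divide_simps power2_eq_square)
      ultimately show ?thesis by (simp only:)
    qed
    from this[OF refl less_imp_neq[OF p, symmetric]] show ?thesis unfolding s_def .
  qed
  moreover have "2 * arctan t * inverse (1 + t\<^sup>2) / 2 = arctan t / (1 + t\<^sup>2)"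
    unfolding divide_inverse[of "arctan t"] by simp
  ultimately show ?thesis by (simp only: diff_divide_distrib)
qed

text \<open>The tangent of \<open>arctan y - arctan c\<close>.\<close>

definition tan_angle :: "real \<Rightarrow> real \<Rightarrow> real" where
  "tan_angle c y = (y - c) / (1 + c * y)"

lemma tan_angle_deriv:
  assumes "1 + c * y \<noteq> 0"
  shows "(tan_angle c has_field_derivative (1 + (tan_angle c y)\<^sup>2) / (1 + y\<^sup>2)) (at y)"
proof -
  have p: "1 + y\<^sup>2 \<noteq> 0" using one_plus_square_pos[of y] by simp
  have "(tan_angle c has_field_derivative (1 * (1 + c * y) - (y - c) * c) / ((1 + c * y) * (1 + c * y))) (at y)"
    unfolding tan_angle_def[abs_def] by (intro DERIV_divide) (use assms in \<open>auto intro!: derivative_eq_intros\<close>)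
  moreover have "(1 * (1 + c * y) - (y - c) * c) / ((1 + c * y) * (1 + c * y)) = (1 + (tan_angle c y)\<^sup>2) / (1 + y\<^sup>2)"
    unfolding tan_angle_def using assms p
    by (simp add: divide_simps power2_eq_square) (simp add: algebra_simps)
  ultimately show ?thesis by (simp only:)
qed

text \<open>For \<open>a < y < b\<close> the terms with \<open>sgn\<close> cancel between \<open>c = a\<close> and \<open>c = b\<close>.\<close>

lemma re_partial_antipode:
  assumes y: "0 < y" and c: "0 < c" and ne: "y \<noteq> c"
  shows "re_partial c (- 1 / y) y =
    (ln (1 + (tan_angle c y)\<^sup>2) / (2 * tan_angle c y) - arctan (tan_angle c y) - sgn (y - c) * (pi / 2)) / (1 + y\<^sup>2)"
proof -
  define t where "t = tan_angle c y"
  define x where "x = - 1 / y"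
  have cy: "0 < 1 + c * y" using y c by (simp add: add_pos_pos)
  have t: "t \<noteq> 0" "sgn t = sgn (y - c)" using ne cy by (simp_all add: t_def tan_angle_def sgn_divide)
  have p: "0 < 1 + y\<^sup>2" by (rule one_plus_square_pos)
  have r: "cr c x y = Complex 0 t"
  proof -
    have xc: "x - c = - (1 + c * y) / y" "x - y = - (1 + y\<^sup>2) / y" "1 + x * y = 0" 
      using y by (simp_all add: x_def field_simps power2_eq_square)
    have frac: "k / (- q / y * w) * (- w / y) = k / q" if "w \<noteq> 0" "q \<noteq> 0" for k q w :: real
      using y that by simp
    have "(y - c) / ((x - c) * (1 + y\<^sup>2)) * (x - y) = t"
      unfolding xc t_def tan_angle_def by (rule frac) (use cy p in auto)
    thus ?thesis unfolding cr_eq xc(3) by (simp add: complex_eq_iff)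
  qed
  have Ln1: "Re (Ln (1 - cr c x y)) = ln (1 + t\<^sup>2) / 2" "Im (Ln (1 - cr c x y)) = - arctan t"
  proof -
    have n: "1 - cr c x y \<noteq> 0" unfolding r by (simp add: complex_eq_iff)
    show "Im (Ln (1 - cr c x y)) = - arctan t"
      unfolding Im_Ln_eq[OF n] by (simp add: r arctan_minus)
    have "norm (1 - cr c x y) = sqrt (1 + t\<^sup>2)" by (simp add: r cmod_def)
    thus "Re (Ln (1 - cr c x y)) = ln (1 + t\<^sup>2) / 2"
      using n one_plus_square_pos[of t] by (simp add: ln_sqrt)
  qed
  have Ln2: "Im (Ln (cr c x y)) = sgn (y - c) * (pi / 2)"
  proof -
    have n: "cr c x y \<noteq> 0" unfolding r using t by (simp add: complex_eq_iff)
    show ?thesis unfolding Im_Ln_eq[OF n] t(2)[symmetric] using t(1) by (simp add: r sgn_if)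
  qed
  have inv: "1 / (of_real y - \<i>) = Complex (y / (1 + y\<^sup>2)) (1 / (1 + y\<^sup>2))"
    by (simp add: complex_eq_iff Re_divide Im_divide power2_eq_square add.commute)
  have A: "1 / (of_real y - of_real c) - 1 / (of_real y - \<i>) = Complex (1 / t / (1 + y\<^sup>2)) (- 1 / (1 + y\<^sup>2))"
  proof -
    have "1 / (y - c) - y / (1 + y\<^sup>2) = 1 / t / (1 + y\<^sup>2)"
      using ne cy p unfolding t_def tan_angle_def
      by (simp add: divide_simps) (simp add: algebra_simps power2_eq_square)
    moreover have "1 / (of_real y - of_real c) = complex_of_real (1 / (y - c))" by simp
    ultimately show ?thesis unfolding inv by (simp add: complex_eq_iff)
  qed
  have B: "1 / (of_real y - \<i>) - 1 / (of_real y - of_real x) = Complex 0 (1 / (1 + y\<^sup>2))"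
  proof -
    have "y - x = (1 + y\<^sup>2) / y" using y by (simp add: x_def field_simps power2_eq_square)
    hence "1 / (of_real y - of_real x) = complex_of_real (y / (1 + y\<^sup>2))" 
      by (metis divide_divide_eq_right mult_1 of_real_1 of_real_diff of_real_divide)
    thus ?thesis unfolding inv by (simp add: complex_eq_iff)
  qed
  have "re_partial c x y = Re (Ln (1 - cr c x y) * Complex (1 / t / (1 + y\<^sup>2)) (- 1 / (1 + y\<^sup>2)) +
      Ln (cr c x y) * Complex 0 (1 / (1 + y\<^sup>2)))"
    unfolding cr_partial_def A B ..
  also have "\<dots> = ln (1 + t\<^sup>2) / 2 * (1 / t / (1 + y\<^sup>2)) - (- arctan t) * (- 1 / (1 + y\<^sup>2)) - sgn (y - c) * (pi / 2) * (1 / (1 + y\<^sup>2))"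
    by (simp only: plus_complex.sel times_complex.sel complex.sel Ln1 Ln2)
  also have "\<dots> = (ln (1 + t\<^sup>2) / (2 * t) - arctan t - sgn (y - c) * (pi / 2)) / (1 + y\<^sup>2)"
    by (simp add: diff_divide_distrib)
  finally show ?thesis unfolding x_def t_def .
qed


section \<open>Points closest to the cone point\<close>

text \<open>The time at which the geodesic from \<open>x\<close> to \<open>y\<close> is closest to \<open>\<i>\<close>.\<close>

definition closest_time :: "real \<Rightarrow> real \<Rightarrow> real" where
  "closest_time x y = ln ((1 + x\<^sup>2) / (1 + y\<^sup>2)) / 2"

lemma exp_closest_time: "(1 + y\<^sup>2) * (exp (closest_time x y))\<^sup>2 = 1 + x\<^sup>2"
proof -
  have "(exp (closest_time x y))\<^sup>2 = exp (ln ((1 + x\<^sup>2) / (1 + y\<^sup>2)))"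
    by (simp add: closest_time_def flip: exp_double)
  also have "\<dots> = (1 + x\<^sup>2) / (1 + y\<^sup>2)"
    using one_plus_square_pos[of x] one_plus_square_pos[of y] by (subst exp_ln) auto
  finally show ?thesis using one_plus_square_pos[of y] by simp
qed

lemma hdist_ii_geod:
  assumes "x < y"
  shows "hdist \<i> (geod (At x) (At y) t) =
     arcosh (((1 + y\<^sup>2) * exp t + (1 + x\<^sup>2) / exp t) / (2 * (y - x)))"
    and "1 \<le> ((1 + y\<^sup>2) * exp t + (1 + x\<^sup>2) / exp t) / (2 * (y - x))"
proof -
  define z where "z = geod (At x) (At y) t"
  define E where "E = exp t"
  have E: "E > 0" "exp (2 * t) = E * E" by (simp_all add: E_def flip: exp_add)
  have pos: "0 < 1 + E * E" using E by (simp add: add_pos_pos)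
  have Re: "Re z = (x + y * (E * E)) / (1 + E * E)" and Im: "Im z = (y - x) * E / (1 + E * E)"
    unfolding z_def geod_exp[OF assms] E(2) E_def[symmetric] by simp_all
  have Im_pos: "0 < Im z" unfolding Im using assms E pos by simp
  have circ: "(Re z)\<^sup>2 + (Im z)\<^sup>2 = (x + y) * Re z - x * y"
    using geod_circle[of x y t] unfolding z_def[symmetric] by (simp add: power2_eq_square algebra_simps)
  have n: "(norm (\<i> - z))\<^sup>2 = (Re z)\<^sup>2 + (1 - Im z)\<^sup>2" by (simp add: cmod_power2)
  have "1 + (norm (\<i> - z))\<^sup>2 / (2 * Im \<i> * Im z) = ((Re z)\<^sup>2 + (Im z)\<^sup>2 + 1) / (2 * Im z)"
    unfolding n using Im_pos by (simp add: field_simps power2_eq_square)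
  also have "\<dots> = ((x + y) * Re z - x * y + 1) / (2 * Im z)" unfolding circ ..
  also have "\<dots> = ((1 + y\<^sup>2) * E + (1 + x\<^sup>2) / E) / (2 * (y - x))"
  proof -
    have "((x + y) * Re z - x * y + 1) * (1 + E * E) = (1 + x\<^sup>2) + (1 + y\<^sup>2) * (E * E)"
      unfolding Re using pos by (simp add: field_simps power2_eq_square)
    moreover have "2 * Im z * (1 + E * E) = 2 * (y - x) * E"
      unfolding Im using pos by simp
    ultimately have "((x + y) * Re z - x * y + 1) / (2 * Im z) =
        ((1 + x\<^sup>2) + (1 + y\<^sup>2) * (E * E)) / (2 * (y - x) * E)"
      using pos by (metis less_irrefl mult_divide_mult_cancel_right)
    also have "(1 + x\<^sup>2) + (1 + y\<^sup>2) * (E * E) = ((1 + y\<^sup>2) * E + (1 + x\<^sup>2) / E) * E"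
      using E(1) by (simp add: distrib_right[of "(1 + y\<^sup>2) * E"] mult.assoc)
    also have "\<dots> / (2 * (y - x) * E) = ((1 + y\<^sup>2) * E + (1 + x\<^sup>2) / E) / (2 * (y - x))"
      using E by simp
    finally show ?thesis .
  qed
  finally have eq: "1 + (norm (\<i> - z))\<^sup>2 / (2 * Im \<i> * Im z) = ((1 + y\<^sup>2) * E + (1 + x\<^sup>2) / E) / (2 * (y - x))" .
  thus "hdist \<i> (geod (At x) (At y) t) =
     arcosh (((1 + y\<^sup>2) * exp t + (1 + x\<^sup>2) / exp t) / (2 * (y - x)))"
    unfolding hdist_def z_def E_def by (simp only:)
  have "0 \<le> (norm (\<i> - z))\<^sup>2 / (2 * Im \<i> * Im z)" using Im_pos by simp
  hence "1 \<le> 1 + (norm (\<i> - z))\<^sup>2 / (2 * Im \<i> * Im z)" by simp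
  thus "1 \<le> ((1 + y\<^sup>2) * exp t + (1 + x\<^sup>2) / exp t) / (2 * (y - x))"
    unfolding eq E_def .
qed

lemma closest_point_iff:
  assumes "x < y"
  shows "p \<in> gline x y \<and> (\<forall>z\<in>gline x y. hdist \<i> p \<le> hdist \<i> z) \<longleftrightarrow>
    p = geod (At x) (At y) (closest_time x y)"
proof -
  define \<tau> where "\<tau> = closest_time x y"
  define h where "h = (\<lambda>t. (1 + y\<^sup>2) * exp t + (1 + x\<^sup>2) / exp t)"
  have le: "hdist \<i> (geod (At x) (At y) s) \<le> hdist \<i> (geod (At x) (At y) t) \<longleftrightarrow> h s \<le> h t" for s t
  proof -
    have "hdist \<i> (geod (At x) (At y) s) \<le> hdist \<i> (geod (At x) (At y) t) \<longleftrightarrow>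
        \<not> h t / (2 * (y - x)) < h s / (2 * (y - x))"
      unfolding hdist_ii_geod(1)[OF assms] h_def
      by (simp only: arcosh_less_iff_real[OF hdist_ii_geod(2)[OF assms, of t] hdist_ii_geod(2)[OF assms, of s]]
            flip: not_less)
    thus ?thesis using assms by (simp add: divide_less_cancel not_less)
  qed
  \<comment> \<open>completing the square: the excess over the value at \<open>\<tau>\<close>\<close>
  have h: "h t = h \<tau> + (1 + y\<^sup>2) * (exp t - exp \<tau>)\<^sup>2 / exp t" for t
  proof -
    have hh: "h t = (1 + y\<^sup>2) * exp t + (1 + y\<^sup>2) * (exp \<tau>)\<^sup>2 / exp t" for t
      unfolding h_def \<tau>_def exp_closest_time ..
    show ?thesis unfolding hh by (simp add: power2_eq_square field_simps)
  qed
  have min: "h \<tau> \<le> h t" for t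
  proof -
    have "0 \<le> (1 + y\<^sup>2) * (exp t - exp \<tau>)\<^sup>2 / exp t" by simp
    thus ?thesis using h[of t] by linarith
  qed
  have uniq: "t = \<tau>" if "h t \<le> h \<tau>" for t
  proof -
    have "0 \<le> (1 + y\<^sup>2) * (exp t - exp \<tau>)\<^sup>2 / exp t" by simp
    hence "(1 + y\<^sup>2) * (exp t - exp \<tau>)\<^sup>2 / exp t = 0" using h[of t] that by linarith
    hence "(exp t - exp \<tau>)\<^sup>2 = 0" using one_plus_square_pos[of y] by simp
    thus ?thesis by simp
  qed
  show ?thesis
  proof
    assume "p \<in> gline x y \<and> (\<forall>z\<in>gline x y. hdist \<i> p \<le> hdist \<i> z)"
    then obtain t where t: "p = geod (At x) (At y) t" "hdist \<i> p \<le> hdist \<i> (geod (At x) (At y) \<tau>)"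
      unfolding gline_def by blast
    hence "h t \<le> h \<tau>" by (simp only: le)
    hence "t = \<tau>" by (rule uniq)
    thus "p = geod (At x) (At y) (closest_time x y)" using t(1) by (simp only: \<tau>_def)
  next
    assume "p = geod (At x) (At y) (closest_time x y)"
    thus "p \<in> gline x y \<and> (\<forall>z\<in>gline x y. hdist \<i> p \<le> hdist \<i> z)"
      using le min unfolding gline_def \<tau>_def by (auto simp del: geod.simps)
  qed
qed

section \<open>Lassos around a cone point\<close>

text \<open>Pairs of endpoints \<open>(y,x)\<close> of the geodesics \<open>[x,y]\<close> that carry lassos around the cone point.\<close>

definition cone_domain :: "real \<Rightarrow> real \<Rightarrow> (real \<times> real) set" where
  "cone_domain a b = {(y, x). a < y \<and> y < b \<and> - 1 / y < x \<and> x < - b}"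

text \<open>The closest point comes before the intersection with \<open>[a,b]\<close> on the way from \<open>x\<close> to \<open>y\<close>. This
  orders the two ends of the segment and makes the integrand positive.\<close>

lemma closest_time_less_cross_time:
  assumes "0 < a" "a < y" "y < b" "- 1 / y < x" "x < - b"
  shows "closest_time x y < cross_time a b x y"
proof -
  define X where "X = - x"
  have X: "X > b" "X * y < 1" using assms by (simp_all add: X_def field_simps)
  have "0 < (X - y) * (1 - X * y)" using X assms by simp
  hence 1: "y * (1 + X\<^sup>2) < X * (1 + y\<^sup>2)" by (simp add: algebra_simps power2_eq_square)
  have "(y - a) * (b - y) < y * X"
    by (rule mult_strict_mono) (use assms X in auto)
  hence "(y - a) * (b - y) * (1 + X\<^sup>2) < y * X * (1 + X\<^sup>2)"
    using one_plus_square_pos[of X] by simp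
  also have "\<dots> = X * (y * (1 + X\<^sup>2))" by simp
  also have "\<dots> < X * (X * (1 + y\<^sup>2))" using 1 X assms by simp
  also have "\<dots> = X * X * (1 + y\<^sup>2)" by simp
  also have "\<dots> < (a + X) * (b + X) * (1 + y\<^sup>2)"
    using one_plus_square_pos[of y] X assms by (intro mult_strict_right_mono mult_strict_mono) auto
  finally have "(1 + x\<^sup>2) * ((y - a) * (b - y)) < (a - x) * (b - x) * (1 + y\<^sup>2)"
    by (simp add: X_def mult.commute)
  hence "(1 + x\<^sup>2) / (1 + y\<^sup>2) < (a - x) * (b - x) / ((y - a) * (b - y))"
    using one_plus_square_pos[of y] assms by (simp add: divide_less_eq less_divide_eq mult_ac)
  moreover have "0 < (1 + x\<^sup>2) / (1 + y\<^sup>2)"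
    using one_plus_square_pos[of y] one_plus_square_pos[of x] by simp
  ultimately show ?thesis unfolding closest_time_def cross_time_def by simp
qed

lemma cone_lasso_vectors_eq:
  assumes a: "0 < a" "a < b" "b < 1"
  shows "cone_lasso_vectors a b = (\<Union>(y, x)\<in>cone_domain a b.
     (\<lambda>t. tvec y x t) ` {- cross_time a b x y..- closest_time x y})"
proof -
  define Q P where "Q = (\<lambda>x y. geod (At x) (At y) (cross_time a b x y))"
    and "P = (\<lambda>x y. geod (At x) (At y) (closest_time x y))"
  have "q \<in> gline x y \<inter> gline a b \<and> p \<in> gline x y \<and> (\<forall>z\<in>gline x y. hdist \<i> p \<le> hdist \<i> z)
      \<longleftrightarrow> q = Q x y \<and> p = P x y" if "a < y" "y < b" "- 1 / y < x" "x < - b" for x y q p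
    using that a closest_point_iff[of x y p] unfolding Q_def P_def
    by (subst gline_Int_gline) (auto simp del: geod.simps)
  hence "cone_lasso_vectors a b = \<Union> {seg_vectors q p |x y q p.
      a < y \<and> y < b \<and> - 1 / y < x \<and> x < - b \<and> q = Q x y \<and> p = P x y}"
    unfolding cone_lasso_vectors_def
    by (intro arg_cong[of _ _ Union] Collect_cong ex_cong1) (intro conj_cong[OF refl], blast)
  also have "\<dots> = (\<Union>(y, x)\<in>cone_domain a b. seg_vectors (Q x y) (P x y))"
    by (auto simp: cone_domain_def simp del: geod.simps)
  also have "\<dots> = (\<Union>(y, x)\<in>cone_domain a b. (\<lambda>t. tvec y x t) ` {- cross_time a b x y..- closest_time x y})"
  proof (rule SUP_cong[OF refl], clarify)
    fix y x assume "(y, x) \<in> cone_domain a b"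
    hence *: "a < y" "y < b" "- 1 / y < x" "x < - b" by (auto simp: cone_domain_def)
    show "seg_vectors (Q x y) (P x y) = (\<lambda>t. tvec y x t) ` {- cross_time a b x y..- closest_time x y}"
      unfolding Q_def P_def
      by (rule seg_vectors_geod) (use * a closest_time_less_cross_time[OF a(1) *] in auto)
  qed
  finally show ?thesis .
qed

text \<open>The integral over \<open>x\<close>, for fixed \<open>y\<close>, of the segment length against the Liouville density: the
  boundary values at \<open>x = - b\<close> minus those at \<open>x = - 1 / y\<close>.\<close>

definition cone_inner :: "real \<Rightarrow> real \<Rightarrow> real \<Rightarrow> real" where
  "cone_inner a b y = re_partial a (- b) y + re_partial b (- b) y - (re_partial a (- 1 / y) y + re_partial b (- 1 / y) y)"

lemma cone_inner_integral:
  assumes a: "0 < a" and y: "a < y" "y < b" and b: "b < 1"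
  shows "(\<integral>\<^sup>+x. indicator {- 1 / y<..<- b} x *
      ennreal (2 * (cross_time a b x y - closest_time x y) / (y - x)\<^sup>2) \<partial>lborel) = ennreal (cone_inner a b y)"
    and "0 \<le> cone_inner a b y"
proof -
  have "b * y < 1 * 1" by (rule mult_strict_mono) (use assms in auto)
  hence le: "- 1 / y < - b" using assms by (simp add: field_simps)
  have deriv: "((\<lambda>x. re_partial a x y + re_partial b x y) has_field_derivative
      2 * (cross_time a b x y - closest_time x y) / (y - x)\<^sup>2) (at x)" if x: "x < 0" for x
  proof -
    have "((\<lambda>x. re_partial a x y + re_partial b x y) has_field_derivative
       - ln (norm (cr a x y)) / (y - x)\<^sup>2 + - ln (norm (cr b x y)) / (y - x)\<^sup>2) (at x)"
      by (intro DERIV_add re_partial_deriv_x) (use x assms in auto)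
    also have "- ln (norm (cr a x y)) / (y - x)\<^sup>2 + - ln (norm (cr b x y)) / (y - x)\<^sup>2 =
       - (ln (norm (cr a x y)) + ln (norm (cr b x y))) / (y - x)\<^sup>2"
      by (simp only: add_divide_distrib minus_add_distrib minus_divide_left)
    also have "- (ln (norm (cr a x y)) + ln (norm (cr b x y))) = 2 * (cross_time a b x y - closest_time x y)"
    proof -
      have l: "ln (norm (cr a x y)) = ln (y - a) + ln (1 + x\<^sup>2) / 2 - (ln (a - x) + ln (1 + y\<^sup>2) / 2)"
        "ln (norm (cr b x y)) = ln (b - y) + ln (1 + x\<^sup>2) / 2 - (ln (b - x) + ln (1 + y\<^sup>2) / 2)"
        unfolding norm_cr using x assms one_plus_square_pos[of x] one_plus_square_pos[of y]
        by (simp_all add: ln_div ln_mult ln_sqrt)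
      have c: "2 * cross_time a b x y = ln (a - x) + ln (b - x) - (ln (y - a) + ln (b - y))"
        "2 * closest_time x y = ln (1 + x\<^sup>2) - ln (1 + y\<^sup>2)"
        unfolding cross_time_def closest_time_def using x assms one_plus_square_pos[of x] one_plus_square_pos[of y]
        by (simp_all add: ln_div ln_mult)
      show ?thesis unfolding right_diff_distrib c l by simp
    qed
    finally show ?thesis .
  qed
  have nonneg: "0 \<le> 2 * (cross_time a b x y - closest_time x y) / (y - x)\<^sup>2" if "- 1 / y < x" "x < - b" for x
    using closest_time_less_cross_time[OF a y that] by simp
  have cont: "continuous_on {- 1 / y..- b} (\<lambda>x. re_partial a x y + re_partial b x y)"
  proof (intro continuous_at_imp_continuous_on ballI)
    fix x assume "x \<in> {- 1 / y..- b}"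
    hence "x < 0" using assms by auto
    from DERIV_isCont[OF deriv[OF this]] show "isCont (\<lambda>x. re_partial a x y + re_partial b x y) x" .
  qed
  have *: "(\<integral>\<^sup>+x. indicator {- 1 / y<..<- b} x *
      ennreal (2 * (cross_time a b x y - closest_time x y) / (y - x)\<^sup>2) \<partial>lborel) =
      ennreal ((re_partial a (- b) y + re_partial b (- b) y) - (re_partial a (- 1 / y) y + re_partial b (- 1 / y) y))"
    "re_partial a (- 1 / y) y + re_partial b (- 1 / y) y \<le> re_partial a (- b) y + re_partial b (- b) y"
    by (rule nn_integral_FTC_Ioo[OF le cont,
        where f = "\<lambda>x. 2 * (cross_time a b x y - closest_time x y) / (y - x)\<^sup>2"]; use deriv nonneg assms in force)+
  show "(\<integral>\<^sup>+x. indicator {- 1 / y<..<- b} x *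
      ennreal (2 * (cross_time a b x y - closest_time x y) / (y - x)\<^sup>2) \<partial>lborel) = ennreal (cone_inner a b y)"
    unfolding cone_inner_def by (rule *)
  show "0 \<le> cone_inner a b y" unfolding cone_inner_def using *(2) by linarith
qed

lemma antipode_primitive_tan_angle_deriv:
  assumes "0 < c" "0 < y" "y \<noteq> c"
  shows "((\<lambda>y. antipode_primitive (tan_angle c y)) has_field_derivative
    (ln (1 + (tan_angle c y)\<^sup>2) / (2 * tan_angle c y) - arctan (tan_angle c y)) / (1 + y\<^sup>2)) (at y)"
proof -
  have cy: "1 + c * y > 0" using assms by (simp add: add_pos_pos)
  have t: "tan_angle c y \<noteq> 0" using assms cy by (simp add: tan_angle_def)
  have p: "1 + (tan_angle c y)\<^sup>2 \<noteq> 0" using one_plus_square_pos[of "tan_angle c y"] by linarith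
  have k: "N / q * (q / w) = N / w" if "q \<noteq> 0" for N q w :: real using that by simp
  have "((\<lambda>y. antipode_primitive (tan_angle c y)) has_field_derivative
    (ln (1 + (tan_angle c y)\<^sup>2) / (2 * tan_angle c y) - arctan (tan_angle c y)) / (1 + (tan_angle c y)\<^sup>2) *
    ((1 + (tan_angle c y)\<^sup>2) / (1 + y\<^sup>2))) (at y)"
    by (rule DERIV_chain2[OF antipode_primitive_deriv[OF t] tan_angle_deriv]) (use cy in simp)
  thus ?thesis unfolding k[OF p] .
qed

lemma isCont_antipodal_tan_angle:
  assumes "0 < c" "0 < y"
  shows "isCont (\<lambda>y. antipode_primitive (tan_angle c y)) y"
proof -
  have "1 + c * y > 0" using assms by (simp add: add_pos_pos)
  hence "isCont (tan_angle c) y" using DERIV_isCont[OF tan_angle_deriv[of c y]] by simp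
  from isCont_o2[OF this isCont_antipodal] show ?thesis .
qed

text \<open>The argument of the dilogarithms, as a function of the normalised lift.\<close>

definition cone_arg :: "real \<Rightarrow> real \<Rightarrow> complex" where
  "cone_arg a b = 2 * of_real b * (of_real a - \<i>) / (of_real (a + b) * (of_real b - \<i>))"

lemma one_minus_cr_corners:
  assumes "0 < a" "a < b"
  shows "1 - cr a (- b) b = cone_arg a b" "1 - cr b (- b) a = 1 / cone_arg a b"
proof -
  have nz: "complex_of_real b \<noteq> 0" "complex_of_real a + of_real b \<noteq> 0" using assms by (simp_all flip: of_real_add)
  have ne: "- complex_of_real b \<noteq> of_real a" "- complex_of_real b \<noteq> of_real b"
    using assms by (simp_all only: of_real_minus[symmetric] of_real_eq_iff)
  have nz': "of_real b - \<i> \<noteq> 0" "of_real a - \<i> \<noteq> 0" by (simp_all)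
  have "1 - cr a (- b) b = (- of_real b - of_real b) * (of_real a - \<i>) / ((- of_real b - of_real a) * (of_real b - \<i>))"
    unfolding of_real_minus by (rule one_minus_cross_ratio) (use ne in auto)
  also have "\<dots> = cone_arg a b"
    unfolding cone_arg_def of_real_add using nz nz' ne by (simp add: divide_simps) (simp add: algebra_simps)
  finally show "1 - cr a (- b) b = cone_arg a b" .
  have "1 - cr b (- b) a = (- of_real b - of_real a) * (of_real b - \<i>) / ((- of_real b - of_real b) * (of_real a - \<i>))"
    unfolding of_real_minus by (rule one_minus_cross_ratio) (use ne in auto)
  also have "\<dots> = 1 / cone_arg a b"
    unfolding cone_arg_def of_real_add using nz nz' ne by (simp add: divide_simps) (simp add: algebra_simps)
  finally show "1 - cr b (- b) a = 1 / cone_arg a b" .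
qed

text \<open>The boundary \<open>x = - b\<close> contributes dilogarithms of the cross ratios at the two corners. The
  contributions of the boundary \<open>x = - 1 / y\<close> for \<open>c = a\<close> and \<open>c = b\<close> cancel: the values of \<open>t\<close> run
  from \<open>0\<close> to \<open>\<tau>\<close> and from \<open>- \<tau>\<close> to \<open>0\<close>, and the primitive is even. Reflection \<open>z \<mapsto> 1 - z\<close> then
  turns the cross ratios into \<open>cone_arg a b\<close> and its inverse.\<close>

lemma cone_outer_integral:
  assumes a: "0 < a" "a < b" "b < 1"
  shows "(\<integral>\<^sup>+y. indicator {a<..<b} y * ennreal (cone_inner a b y) \<partial>lborel) =
      ennreal (2 * Re (Rogers_L (cone_arg a b) - Rogers_L (1 / cone_arg a b)))"
    and "0 \<le> 2 * Re (Rogers_L (cone_arg a b) - Rogers_L (1 / cone_arg a b))"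
proof -
  define P where "P = (\<lambda>y. Re (- 2 * Rogers_L (cr a (- b) y)) + Re (- 2 * Rogers_L (cr b (- b) y)) -
     (antipode_primitive (tan_angle a y) + antipode_primitive (tan_angle b y)))"
  have cont: "continuous_on {a..b} P"
  proof (intro continuous_at_imp_continuous_on ballI)
    fix y assume y: "y \<in> {a..b}"
    show "isCont P y" unfolding P_def
      by (intro continuous_add continuous_diff isCont_Re_Rogers_L_cr isCont_antipodal_tan_angle)
         (use y a in auto)
  qed
  have deriv: "(P has_field_derivative cone_inner a b y) (at y)" if y: "a < y" "y < b" for y
  proof -
    have "re_partial a (- 1 / y) y + re_partial b (- 1 / y) y =
      (ln (1 + (tan_angle a y)\<^sup>2) / (2 * tan_angle a y) - arctan (tan_angle a y)) / (1 + y\<^sup>2) +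
      (ln (1 + (tan_angle b y)\<^sup>2) / (2 * tan_angle b y) - arctan (tan_angle b y)) / (1 + y\<^sup>2)"
      using re_partial_antipode[of y a] re_partial_antipode[of y b] y a by (simp add: add_divide_distrib diff_divide_distrib)
    thus ?thesis unfolding P_def cone_inner_def
      by (auto intro!: DERIV_add DERIV_diff Re_Rogers_L_cr_deriv_y antipode_primitive_tan_angle_deriv simp only:)
         (use y a in auto)
  qed
  have *: "(\<integral>\<^sup>+y. indicator {a<..<b} y * ennreal (cone_inner a b y) \<partial>lborel) = ennreal (P b - P a)" "P a \<le> P b"
    by (rule nn_integral_FTC_Ioo[OF a(2) cont deriv]; use a cone_inner_integral(2) in auto)+
  have "tan_angle a b = (- (a - b)) / (1 + b * a)" by (simp add: tan_angle_def mult.commute)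
  hence t: "tan_angle a b = - tan_angle b a" "tan_angle a a = 0" "tan_angle b b = 0"
    by (simp_all only: minus_divide_left[symmetric]) (simp_all add: tan_angle_def)
  have "P b - P a = Re (- 2 * Rogers_L (cr a (- b) b)) - Re (- 2 * Rogers_L (cr b (- b) a))"
    unfolding P_def t antipode_primitive_even cr_diagonal Rogers_L_0 by simp
  also have "\<dots> = 2 * Re (Rogers_L (cone_arg a b) - Rogers_L (1 / cone_arg a b))"
  proof -
    have "cr a (- b) b \<in> Rogers_dom" "cr b (- b) a \<in> Rogers_dom"
      by (rule cr_in_Rogers_dom; use a in auto)+
    from this[THEN Rogers_L_reflection]
    have "Rogers_L (cr a (- b) b) = 2 * Rogers_L (1 / 2) - Rogers_L (cone_arg a b)"
      "Rogers_L (cr b (- b) a) = 2 * Rogers_L (1 / 2) - Rogers_L (1 / cone_arg a b)"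
      unfolding one_minus_cr_corners[OF a(1,2)] by (simp_all add: algebra_simps)
    thus ?thesis by simp
  qed
  finally have eq: "P b - P a = 2 * Re (Rogers_L (cone_arg a b) - Rogers_L (1 / cone_arg a b))" .
  show "(\<integral>\<^sup>+y. indicator {a<..<b} y * ennreal (cone_inner a b y) \<partial>lborel) =
      ennreal (2 * Re (Rogers_L (cone_arg a b) - Rogers_L (1 / cone_arg a b)))"
    using *(1) unfolding eq .
  show "0 \<le> 2 * Re (Rogers_L (cone_arg a b) - Rogers_L (1 / cone_arg a b))"
    using *(2) eq by linarith
qed

lemma closest_time_measurable [measurable]:
  "(\<lambda>p. closest_time (snd p) (fst p)) \<in> borel_measurable borel"
  unfolding closest_time_def borel_prod[symmetric] by measurable

lemma measure_cone_lasso_vectors: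
  assumes a: "0 < a" "a < b" "b < 1"
  shows "measure Liouville (cone_lasso_vectors a b) =
     2 * Re (Rogers_L (cone_arg a b) - Rogers_L (1 / cone_arg a b))"
proof -
  have D: "cone_domain a b \<in> sets borel"
  proof -
    have "cone_domain a b = {p. a < fst p \<and> fst p < b \<and> - 1 < snd p * fst p \<and> snd p < - b}"
      using a by (auto simp: cone_domain_def field_simps)
    also have "open \<dots>" by (intro open_Collect_conj open_Collect_less continuous_intros)
    ultimately show ?thesis by simp
  qed
  have "emeasure Liouville (cone_lasso_vectors a b) = 
     emeasure Liouville (\<Union>(y, x)\<in>cone_domain a b. (\<lambda>t. tvec y x t) `
       {(\<lambda>p. - cross_time a b (snd p) (fst p)) (y, x)..(\<lambda>p. - closest_time (snd p) (fst p)) (y, x)})"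
    unfolding cone_lasso_vectors_eq[OF a] by simp
  also have "\<dots> = (\<integral>\<^sup>+y. \<integral>\<^sup>+x. indicator (cone_domain a b) (y, x) *
      ennreal (2 * ((\<lambda>p. - closest_time (snd p) (fst p)) (y, x) - (\<lambda>p. - cross_time a b (snd p) (fst p)) (y, x)) / (y - x)\<^sup>2) \<partial>lborel \<partial>lborel)"
    by (rule emeasure_Liouville_fibred[OF D])
       (use a closest_time_less_cross_time in \<open>auto simp: cone_domain_def less_imp_le\<close>)
  also have "\<dots> = (\<integral>\<^sup>+y. indicator {a<..<b} y * (\<integral>\<^sup>+x. indicator {- 1 / y<..<- b} x *
      ennreal (2 * (cross_time a b x y - closest_time x y) / (y - x)\<^sup>2) \<partial>lborel) \<partial>lborel)"
    by (intro nn_integral_cong) (auto simp: indicator_def cone_domain_def intro!: nn_integral_cong)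
  also have "\<dots> = (\<integral>\<^sup>+y. indicator {a<..<b} y * ennreal (cone_inner a b y) \<partial>lborel)"
    by (intro nn_integral_cong) (use a cone_inner_integral in \<open>auto simp: indicator_def\<close>)
  also have "\<dots> = ennreal (2 * Re (Rogers_L (cone_arg a b) - Rogers_L (1 / cone_arg a b)))"
    by (rule cone_outer_integral[OF a])
  finally show ?thesis
    using cone_outer_integral(2)[OF a] by (simp add: measure_def)
qed


section \<open>Normalised lifts of the hexagon\<close>

text \<open>The reflection in the line over \<open>m\<close> maps the centre of one half circle to the centre of the
  other.\<close>

lemma vertical_reflection_gline:
  assumes "vertical_reflection m ` gline c d = gline e f" "c < d" "e < f"
  shows "4 * m = c + d + e + f"
proof -
  have eq: "(c + d + e + f - 4 * m) * Re z + (4 * m\<^sup>2 - 2 * m * (e + f) + e * f - c * d) = 0" if "z \<in> gline c d" for z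
  proof -
    have "(Re z - c) * (Re z - d) + (Im z)\<^sup>2 = 0" using that assms(2) by (simp add: gline_iff)
    moreover have "vertical_reflection m z \<in> gline e f" using that assms(1) by blast
    hence "(2 * m - Re z - e) * (2 * m - Re z - f) + (Im z)\<^sup>2 = 0"
      using assms(3) by (simp add: gline_iff vertical_reflection_def)
    ultimately show ?thesis by (simp add: algebra_simps power2_eq_square)
  qed
  define z where "z = (\<lambda>t. geod (At c) (At d) t)"
  have z: "z t \<in> gline c d" for t by (simp add: z_def gline_def del: geod.simps)
  have "(c + d + e + f - 4 * m) * (Re (z 1) - Re (z 0)) = 0"
    using eq[OF z[of 1]] eq[OF z[of 0]] by (simp add: algebra_simps)
  moreover have "Re (z 0) < Re (z 1)"
    unfolding z_def using assms(2) by (rule Re_geod_strict_mono) simp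
  ultimately show ?thesis by simp
qed

lemma cusp_seam:
  assumes Q: "cusp_normalised Q a" and seam: "is_seam (seam_\<gamma>\<alpha> Q)"
  shows "seam_src (seam_\<gamma>\<alpha> Q) = At (2 + a)" "seam_beg (seam_\<gamma>\<alpha> Q) = ereal (ln a)"
proof -
  let ?c = "seam_\<gamma>\<alpha> Q"
  have a: "0 < a" and tgt: "seam_tgt ?c = Infty" using Q by (auto simp: cusp_normalised_def)
  then obtain x where src: "seam_src ?c = At x"
    using seam by (cases "seam_src ?c") (auto simp: is_seam_def)
  obtain s v where s: "seam_beg ?c = ereal s" and pt: "geod (At 2) (At (2 + 2 * a)) v = seam_pt ?c s"
    and vel: "seam_vel ?c s = \<i> * geod_vel (At 2) (At (2 + 2 * a)) v"
    using Q unfolding cusp_normalised_def boundary_side_def by blast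
  have "Re (\<i> * geod_vel (At 2) (At (2 + 2 * a)) v) = 0"
    unfolding vel[symmetric] by (simp add: seam_vel_def src tgt geod_vel_At_Infty)
  hence "sinh v = 0" using a by (simp add: geod_vel_At_At)
  hence v: "v = 0" by simp
  have "x = 2 + a" "exp s = a"
    using pt a unfolding seam_pt_def src tgt v by simp_all
  thus "seam_src ?c = At (2 + a)" "seam_beg ?c = ereal (ln a)" using src s by auto
qed

lemma cusp_truncated_seam_length:
  assumes Q: "cusp_normalised Q a" and seam: "is_seam (seam_\<gamma>\<alpha> Q)"
  shows "truncated_seam_length Q = - ln a"
proof -
  let ?c = "seam_\<gamma>\<alpha> Q"
  note c = cusp_seam[OF assms]
  have a: "0 < a" and tgt: "seam_tgt ?c = Infty" using Q by (auto simp: cusp_normalised_def)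
  obtain m where m: "seam_tgt (seam_\<alpha>\<beta> Q) = At m" "vertical_reflection m ` gline 2 (2 + 2 * a) = gline 0 (2 * a)"
    using Q unfolding cusp_normalised_def by blast
  have m_eq: "m = 1 + a" using vertical_reflection_gline[OF m(2)] a by simp
  have len: "hyp_length (\<lambda>x. Complex x h) (1 + a) (2 + a) = 1 / h" for h
  proof -
    have "((\<lambda>x. Complex x h) has_vector_derivative 1) (at u)" for u
      unfolding has_vector_derivative_complex_iff by (auto intro!: derivative_eq_intros)
    hence "vector_derivative (\<lambda>x. Complex x h) (at u) = 1" for u
      by (rule vector_derivative_at)
    thus ?thesis by (simp add: hyp_length_def)
  qed
  have h: "collar_height Q = 1"
    unfolding collar_height_def c(1) m(1) coord.simps m_eq len
    by (rule the_equality) (auto simp: field_simps)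
  have pt: "Im (seam_pt ?c r) = exp r" for r by (simp add: seam_pt_def c(1) tgt)
  show ?thesis
    unfolding truncated_seam_length_def h pt c(2)
    by (rule the_equality) auto
qed

lemma cusp_lasso_vectors_unique:
  assumes Q: "cusp_normalised Q a" and seam: "is_seam (seam_\<gamma>\<alpha> Q)"
  shows "lasso_vectors Q = cusp_lasso_vectors a"
proof -
  have cusp: "cusp_normalised Q a' \<longleftrightarrow> a' = a" for a'
    using cusp_seam(1)[OF Q seam] cusp_seam(1)[OF _ seam, of a'] Q by auto
  have "seam_end (seam_\<gamma>\<alpha> Q) = \<infinity>" using Q by (simp add: cusp_normalised_def)
  hence cone: "\<not> cone_normalised Q a' b'" for a' b'
    by (simp add: cone_normalised_def)
  show ?thesis unfolding lasso_vectors_def by (simp only: cusp cone) simp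
qed

lemma La_cusp:
  assumes Q: "cusp_normalised Q a" and seam: "is_seam (seam_\<gamma>\<alpha> Q)"
  shows "of_real (La Q) = 4 * Rogers_L (of_real (1 / (1 + exp (truncated_seam_length Q))))"
proof -
  have a: "0 < a" "a < 1" using Q by (auto simp: cusp_normalised_def)
  have ex: "exp (truncated_seam_length Q) = 1 / a"
    unfolding cusp_truncated_seam_length[OF assms] using a by (simp add: exp_minus divide_inverse)
  have "1 / (1 + exp (truncated_seam_length Q)) = a / (1 + a)"
    unfolding ex using a by (simp add: field_simps)
  thus ?thesis
    unfolding La_def cusp_lasso_vectors_unique[OF assms] measure_cusp_lasso_vectors[OF a] by (simp only:)
qed

text \<open>The geodesic through \<open>\<i>\<close> at time \<open>r\<close> with direction \<open>\<i> cis \<phi>\<close> has centre \<open>sinh r\<close> and radius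
  \<open>cosh r\<close>, and \<open>cot \<phi> = - sinh r\<close>.\<close>

lemma seam_through_ii:
  assumes ne: "p \<noteq> q" and pt: "geod p q r = \<i>" and vel: "geod_vel p q r = Complex (- sin \<phi>) (cos \<phi>)"
    and sin: "0 < sin \<phi>"
  shows "cot \<phi> = - sinh r"
    "geod p q t = Complex (sinh r - cosh r * tanh t) (cosh r / cosh t)"
    "geod_vel p q t = Complex (- cosh r / (cosh t)\<^sup>2) (- cosh r * sinh t / (cosh t)\<^sup>2)"
proof -
  obtain x y where xy: "p = At x" "q = At y"
  proof (cases p; cases q)
    fix x y assume "p = At x" "q = At y"
    thus ?thesis by (rule that)
  qed (use ne vel sin in \<open>auto simp: geod_vel_Infty_At geod_vel_At_Infty\<close>)
  have C: "cosh r > 0" by simp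
  have v: "(y - x) / 2 / (cosh r)\<^sup>2 = - sin \<phi>" "- (\<bar>y - x\<bar> / 2) * sinh r / (cosh r)\<^sup>2 = cos \<phi>"
    using vel unfolding xy geod_vel_At_At by simp_all
  have "(y - x) / 2 / (cosh r)\<^sup>2 < 0" using v(1) sin by simp
  hence neg: "y - x < 0" using C by (simp add: divide_less_0_iff)
  have p: "(x + y) / 2 + (y - x) / 2 * tanh r = 0" "\<bar>y - x\<bar> / 2 / cosh r = 1"
    using pt unfolding xy geod.simps complex_eq_iff complex.sel imaginary_unit.sel by blast+
  have \<rho>: "(y - x) / 2 = - cosh r" "\<bar>y - x\<bar> / 2 = cosh r" using p(2) neg by (simp_all add: field_simps)
  have c: "(x + y) / 2 = sinh r"
    using p(1) unfolding \<rho> by (simp add: tanh_def)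
  have "sin \<phi> = 1 / cosh r" "cos \<phi> = - sinh r / cosh r"
    using v unfolding \<rho> by (simp_all add: power2_eq_square)
  thus "cot \<phi> = - sinh r" by (simp add: cot_def)
  show "geod p q t = Complex (sinh r - cosh r * tanh t) (cosh r / cosh t)"
    unfolding xy geod.simps \<rho> c by simp
  show "geod_vel p q t = Complex (- cosh r / (cosh t)\<^sup>2) (- cosh r * sinh t / (cosh t)\<^sup>2)"
    unfolding xy geod_vel_At_At \<rho> by simp
qed

text \<open>This geodesic leaves \<open>[a,b]\<close> at a right angle at time \<open>s\<close>. Comparing base points and velocities
  expresses \<open>a\<close> and \<open>b\<close> by \<open>r\<close> and \<open>s\<close>.\<close>

lemma perpendicular_through_ii:
  assumes ab: "a < b"
    and pt: "geod (At a) (At b) v = Complex (sinh r - cosh r * tanh s) (cosh r / cosh s)"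
    and vel: "Complex (- cosh r / (cosh s)\<^sup>2) (- cosh r * sinh s / (cosh s)\<^sup>2) = \<i> * geod_vel (At a) (At b) v"
  shows "sinh s < 0" "(b - a) * sinh s = - 2 * cosh r" "(a + b) * sinh s = 2 * (sinh r * sinh s - cosh r * cosh s)"
proof -
  define C S s' V v' g where "C = cosh r" and "S = cosh s" and "s' = sinh s" and "V = cosh v" and "v' = sinh v"
    and "g = (b - a) / 2"
  note defs = C_def S_def s'_def V_def v'_def g_def
  have pos: "C > 0" "S > 0" "V > 0" "g > 0" using ab by (simp_all add: defs)
  have abs: "\<bar>b - a\<bar> / 2 = g" using ab by (simp add: g_def)
  have p: "(a + b) / 2 + g * (v' / V) = sinh r - C * (s' / S)" "g / V = C / S"
    using pt unfolding geod.simps abs by (simp_all add: defs tanh_def)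
  have w: "- C / S\<^sup>2 = g * v' / V\<^sup>2" "- C * s' / S\<^sup>2 = g / V\<^sup>2"
    using vel unfolding geod_vel_At_At abs by (simp_all add: complex_eq_iff defs)
  have g: "g = C * V / S" using p(2) pos by (simp add: field_simps)
  have 1: "V = - v' * S"
  proof -
    have "- C * V\<^sup>2 = g * v' * S\<^sup>2" using w(1) pos by (simp add: field_simps)
    hence "C * V * (- V) = C * V * (v' * S)" unfolding g using pos by (simp add: power2_eq_square)
    moreover have "C * V \<noteq> 0" using pos by simp
    ultimately have "- V = v' * S" using mult_left_cancel by blast
    thus ?thesis by simp
  qed
  have 2: "S = - s' * V"
  proof -
    have "- C * s' * V\<^sup>2 = g * S\<^sup>2" using w(2) pos by (simp add: field_simps)
    hence "C * V * (- s' * V) = C * V * S" unfolding g using pos by (simp add: power2_eq_square mult_ac)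
    moreover have "C * V \<noteq> 0" using pos by simp
    ultimately have "- s' * V = S" using mult_left_cancel by blast
    thus ?thesis by simp
  qed
  have "s' * V < 0" using 2 pos by simp
  hence s': "s' < 0" using pos by (simp add: mult_less_0_iff)
  thus "sinh s < 0" by (simp add: s'_def)
  have V: "V = - S / s'" using 2 s' by (simp add: field_simps)
  have v': "v' = 1 / s'" using 1 V pos s' by (simp add: field_simps)
  have g': "g * s' = - C" unfolding g V using pos s' by simp
  thus "(b - a) * sinh s = - 2 * cosh r" by (simp add: defs field_simps)
  have vV: "v' / V = - 1 / S" unfolding v' V using s' pos by simp
  have sum: "(a + b) / 2 = sinh r - C * (s' / S) + g / S"
  proof -
    have "g * (- 1 / S) = - (g / S)" by simp
    thus ?thesis using p(1) unfolding vV by linarith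
  qed
  have "((a + b) / 2) * s' = sinh r * s' - C * (s' / S) * s' + g * s' / S"
    unfolding sum by (simp add: algebra_simps)
  also have "\<dots> = sinh r * s' - C * ((s' * s' + 1) / S)" unfolding g' by (simp add: algebra_simps add_divide_distrib)
  also have "s' * s' + 1 = S * S" using cosh_square_eq[of s] by (simp add: defs power2_eq_square)
  also have "S * S / S = S" using pos by simp
  finally show "(a + b) * sinh s = 2 * (sinh r * sinh s - cosh r * cosh s)"
    by (simp add: defs field_simps)
qed

lemma seam_length_and_angle:
  fixes a b r s :: real
  assumes s: "sinh s \<noteq> 0" and d: "(b - a) * sinh s = - 2 * cosh r"
    and c: "(a + b) * sinh s = 2 * (sinh r * sinh s - cosh r * cosh s)"
  shows "sinh (r - s) * (b - a) = 1 + a * b" "1 - a * b = - sinh r * (a + b)"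
proof -
  define R C S s' where "R = sinh r" and "C = cosh r" and "S = cosh s" and "s' = sinh s"
  have sq: "C * C = R * R + 1" "S * S = s' * s' + 1"
    using cosh_square_eq[of r] cosh_square_eq[of s] by (simp_all add: R_def C_def S_def s'_def power2_eq_square)
  have e: "(b - a) * s' = - 2 * C" "(a + b) * s' = 2 * (R * s' - C * S)"
    using d c by (simp_all add: R_def C_def S_def s'_def)
  have "4 * (a * b) * (s' * s') = ((a + b) * s') * ((a + b) * s') - ((b - a) * s') * ((b - a) * s')"
    by (simp add: algebra_simps)
  also have "\<dots> = 4 * ((R * s' - C * S) * (R * s' - C * S) - C * C)" unfolding e by algebra
  finally have ab: "a * b * (s' * s') = (R * s' - C * S) * (R * s' - C * S) - C * C" by simp
  have nz: "s' * s' \<noteq> 0" using s by (simp add: s'_def)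
  have "(R * S - C * s') * (b - a) * (s' * s') = (R * S - C * s') * s' * ((b - a) * s')" by simp
  also have "\<dots> = s' * s' + ((R * s' - C * S) * (R * s' - C * S) - C * C)"
    unfolding e(1) using sq by algebra
  also have "\<dots> = (1 + a * b) * (s' * s')" unfolding ab[symmetric] by (simp add: algebra_simps)
  finally have "(R * S - C * s') * (b - a) = 1 + a * b" using nz by simp
  thus "sinh (r - s) * (b - a) = 1 + a * b"
    by (simp add: sinh_diff R_def C_def S_def s'_def mult.commute)
  have "(1 - a * b) * (s' * s') = s' * s' - ((R * s' - C * S) * (R * s' - C * S) - C * C)"
    unfolding ab[symmetric] by (simp add: algebra_simps)
  also have "\<dots> = - R * s' * (2 * (R * s' - C * S))" using sq by algebra
  also have "\<dots> = - R * (a + b) * (s' * s')" unfolding e(2)[symmetric] by simp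
  finally have "1 - a * b = - R * (a + b)" using nz mult_right_cancel by blast
  thus "1 - a * b = - sinh r * (a + b)" by (simp add: R_def)
qed

text \<open>The seam between \<open>\<alpha>\<close> and \<open>\<beta>\<close> leaves \<open>\<i>\<close> vertically downwards, so the angle \<open>\<theta> / 2\<close> of the
  hexagon at \<open>\<i>\<close> fixes the direction in which the seam from \<open>\<gamma>\<close> arrives.\<close>

lemma cone_seam:
  assumes Q: "cone_normalised Q a b" and seam: "is_seam (seam_\<gamma>\<alpha> Q)"
    and meet: "meet_at (Cone \<theta>) (seam_\<gamma>\<alpha> Q) (seam_\<alpha>\<beta> Q)"
    and r: "seam_end (seam_\<gamma>\<alpha> Q) = ereal r" and s: "seam_beg (seam_\<gamma>\<alpha> Q) = ereal s"
  shows "cot (\<theta> / 2) = - sinh r" "sinh s < 0" "(b - a) * sinh s = - 2 * cosh r"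
    "(a + b) * sinh s = 2 * (sinh r * sinh s - cosh r * cosh s)"
proof -
  let ?c = "seam_\<gamma>\<alpha> Q" and ?d = "seam_\<alpha>\<beta> Q"
  have ab: "0 < a" "a < b" and c_r: "seam_pt ?c r = \<i>" using Q r by (auto simp: cone_normalised_def)
  obtain m where d: "seam_src ?d = Infty" "seam_tgt ?d = At m"
    using Q unfolding cone_normalised_def by blast
  obtain s' where th: "0 < \<theta>" "\<theta> < 2 * pi" and d_pt: "seam_pt ?c r = seam_pt ?d s'"
    and d_vel: "seam_vel ?d s' = cis (pi - \<theta> / 2) * seam_vel ?c r"
    using meet r by auto
  have sin: "0 < sin (\<theta> / 2)" by (rule sin_gt_zero) (use th in auto)
  have "exp (- s') = 1" using c_r d_pt unfolding seam_pt_def d by (simp add: complex_eq_iff)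
  hence "seam_vel ?d s' = - \<i>" unfolding seam_vel_def d geod_vel_Infty_At by (simp add: complex_eq_iff)
  hence "cis (pi - \<theta> / 2) * seam_vel ?c r = - \<i>" using d_vel by simp
  hence "cis (\<theta> / 2 - pi) * (cis (pi - \<theta> / 2) * seam_vel ?c r) = cis (\<theta> / 2 - pi) * (- \<i>)" by simp
  hence "seam_vel ?c r = cis (\<theta> / 2 - pi) * (- \<i>)"
    by (simp add: mult.assoc[symmetric] cis_mult)
  hence vel: "seam_vel ?c r = Complex (- sin (\<theta> / 2)) (cos (\<theta> / 2))"
    by (simp add: complex_eq_iff sin_diff cos_diff)
  have ne: "seam_src ?c \<noteq> seam_tgt ?c" using seam by (simp add: is_seam_def)
  note through = seam_through_ii[OF ne c_r[unfolded seam_pt_def] vel[unfolded seam_vel_def] sin]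
  show "cot (\<theta> / 2) = - sinh r" by (rule through(1))
  obtain v where pt: "geod (At a) (At b) v = seam_pt ?c s" and vel: "seam_vel ?c s = \<i> * geod_vel (At a) (At b) v"
    using Q s unfolding cone_normalised_def boundary_side_def by auto
  note perp = perpendicular_through_ii[OF ab(2) pt[unfolded seam_pt_def through(2)] vel[unfolded seam_vel_def through(3)]]
  show "sinh s < 0" "(b - a) * sinh s = - 2 * cosh r"
    "(a + b) * sinh s = 2 * (sinh r * sinh s - cosh r * cosh s)" by (rule perp)+
qed

lemma cone_normalised_times:
  assumes "cone_normalised Q a b"
  obtains r s where "seam_end (seam_\<gamma>\<alpha> Q) = ereal r" "seam_beg (seam_\<gamma>\<alpha> Q) = ereal s"
  using assms unfolding cone_normalised_def boundary_side_def by blast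

lemma cone_lasso_vectors_unique:
  assumes Q: "cone_normalised Q a b" and seam: "is_seam (seam_\<gamma>\<alpha> Q)"
    and meet: "meet_at (Cone \<theta>) (seam_\<gamma>\<alpha> Q) (seam_\<alpha>\<beta> Q)"
  shows "lasso_vectors Q = cone_lasso_vectors a b"
proof -
  obtain r s where rs: "seam_end (seam_\<gamma>\<alpha> Q) = ereal r" "seam_beg (seam_\<gamma>\<alpha> Q) = ereal s"
    by (rule cone_normalised_times[OF Q])
  have "a' = a \<and> b' = b" if Q': "cone_normalised Q a' b'" for a' b'
  proof -
    note 1 = cone_seam[OF Q seam meet rs] and 2 = cone_seam[OF Q' seam meet rs]
    have "(b - a) * sinh s = (b' - a') * sinh s" "(a + b) * sinh s = (a' + b') * sinh s"
      using 1 2 by simp_all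
    hence "b - a = b' - a'" "a + b = a' + b'" using 1(2) by simp_all
    thus ?thesis by linarith
  qed
  hence cone: "cone_normalised Q a' b' \<longleftrightarrow> a' = a \<and> b' = b" for a' b'
    using Q by blast
  have cusp: "\<not> cusp_normalised Q a'" for a'
    by (simp add: cusp_normalised_def rs(1))
  show ?thesis unfolding lasso_vectors_def by (simp only: cusp cone) simp
qed

lemma cone_arg_eq:
  assumes ab: "0 < a" "a < b" and sm: "sm * (b - a) = 1 + a * b" and ct: "1 - a * b = ct * (a + b)"
  shows "(of_real sm + of_real ct) / (of_real sm + \<i>) = cone_arg a b"
proof -
  define D where "D = (b - a) * (a + b)"
  have D: "D \<noteq> 0" using ab by (simp add: D_def)
  have "(sm + ct) * D = (sm * (b - a)) * (a + b) + (ct * (a + b)) * (b - a)"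
    by (simp add: D_def algebra_simps)
  also have "\<dots> = 2 * b * (1 + a * a)" unfolding sm ct[symmetric] by (simp add: algebra_simps)
  finally have "complex_of_real ((sm + ct) * D) = of_real (2 * b * (1 + a * a))" by (simp only:)
  hence num: "(of_real sm + of_real ct) * complex_of_real D = 2 * of_real b * (of_real a - \<i>) * (of_real a + \<i>)"
    by (simp add: algebra_simps)
  \<comment> \<open>\<open>1 + a b + \<i> (b - a) = (b - \<i>) (a + \<i>)\<close>\<close>
  have "complex_of_real (sm * (b - a)) = of_real (1 + a * b)" unfolding sm ..
  hence "(of_real sm + \<i>) * of_real (b - a) = (of_real b - \<i>) * (of_real a + \<i>)"
    by (simp add: algebra_simps)
  hence den: "(of_real sm + \<i>) * complex_of_real D = of_real (a + b) * (of_real b - \<i>) * (of_real a + \<i>)"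
    by (simp add: D_def mult_ac)
  have nz: "of_real a + \<i> \<noteq> 0" by (simp add: complex_eq_iff)
  have "(of_real sm + of_real ct) / (of_real sm + \<i>) =
      ((of_real sm + of_real ct) * complex_of_real D) / ((of_real sm + \<i>) * complex_of_real D)"
    using D by simp
  also have "\<dots> = cone_arg a b" unfolding num den cone_arg_def using nz by simp
  finally show ?thesis .
qed

lemma La_cone:
  assumes Q: "cone_normalised Q a b" and seam: "is_seam (seam_\<gamma>\<alpha> Q)"
    and meet: "meet_at (Cone \<theta>) (seam_\<gamma>\<alpha> Q) (seam_\<alpha>\<beta> Q)"
    and z: "z = (of_real (sinh (seam_length Q)) + of_real (cot (\<theta> / 2))) / (of_real (sinh (seam_length Q)) + \<i>)"
  shows "La Q = 2 * Re (Rogers_L z - Rogers_L (1 / z))"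
proof -
  have ab: "0 < a" "a < b" "b < 1" using Q by (auto simp: cone_normalised_def)
  obtain r s where rs: "seam_end (seam_\<gamma>\<alpha> Q) = ereal r" "seam_beg (seam_\<gamma>\<alpha> Q) = ereal s"
    by (rule cone_normalised_times[OF Q])
  note c = cone_seam[OF Q seam meet rs]
  have len: "seam_length Q = r - s" by (simp add: seam_length_def rs)
  have "z = cone_arg a b"
    unfolding z len c(1)
    by (rule cone_arg_eq[OF ab(1,2)]) (use seam_length_and_angle[OF less_imp_neq[OF c(2)] c(3,4)] in auto)
  thus ?thesis
    unfolding La_def cone_lasso_vectors_unique[OF Q seam meet] measure_cone_lasso_vectors[OF ab] by (simp only:)
qed

theorem proposition1p11:
  fixes \<alpha> \<beta> :: boundary_element and j k :: nat and l :: real and Q :: hexagon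
  assumes "1 \<le> j" and "1 \<le> k"
    and "pants_lift (grade j \<alpha>) (grade k \<beta>) l Q"
  shows "(\<alpha> = Cusp \<and> (\<exists>a. cusp_normalised Q a) \<longrightarrow>
            of_real (La Q) =
              4 * Rogers_L (of_real (1 / (1 + exp (truncated_seam_length Q))))) \<and>
         (\<forall>\<theta>\<alpha> \<theta> z. \<alpha> = Cone \<theta>\<alpha> \<and> \<theta> = real j * \<theta>\<alpha> \<and> \<theta> \<le> pi / 2 \<and>
            (\<exists>a b. cone_normalised Q a b) \<and>
            z = (of_real (sinh (seam_length Q)) + of_real (cot (\<theta> / 2)))
                  / (of_real (sinh (seam_length Q)) + \<i>) \<longrightarrow>
            La Q = 2 * Re (Rogers_L z - Rogers_L (1 / z)))"
proof (intro conjI allI impI; elim conjE exE)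
  have seam: "is_seam (seam_\<gamma>\<alpha> Q)" and meet: "meet_at (grade j \<alpha>) (seam_\<gamma>\<alpha> Q) (seam_\<alpha>\<beta> Q)"
    using assms(3) by (simp_all only: pants_lift_def)
  show "of_real (La Q) = 4 * Rogers_L (of_real (1 / (1 + exp (truncated_seam_length Q))))"
    if "cusp_normalised Q a" for a
    using that seam by (rule La_cusp)
  show "La Q = 2 * Re (Rogers_L z - Rogers_L (1 / z))"
    if "\<alpha> = Cone \<theta>\<alpha>" "\<theta> = real j * \<theta>\<alpha>" "cone_normalised Q a b"
      "z = (of_real (sinh (seam_length Q)) + of_real (cot (\<theta> / 2))) / (of_real (sinh (seam_length Q)) + \<i>)"
    for \<theta>\<alpha> \<theta> z a b
    using La_cone[OF that(3) seam _ that(4)] meet that(1,2) by simp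
qed

end
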